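(* Let $(Q,L_d,\mathcal{D},\mathcal{D}_d)$ be a nonholonomic discrete mechanical system with symmetry group $G$, with connection $\mathcal{A}$ and affine discrete connection $\mathcal{A}_d$ on $\pi:Q\to Q/G$ as in the context. Let $q_\cdot=(q_0,\dots,q_N)$ be a discrete curve in $Q$ and $r_k=\pi(q_k)$, $w_k=\mathcal{A}_d(q_k,q_{k+1})$, $v_k=\rho(q_k,w_k)$. Then the following conditions are equivalent. (1) $q_\cdot$ satisfies the vertical variational principle: $dS_d(q_\cdot)(\delta q_\cdot^{\mathcal{S}})=0$ for all vanishing end points variations with $\delta q_k^{\mathcal{S}}\in\mathcal{S}_{q_k}$ for all $k$. (2) The condition $\bar{\psi}|_{(F_1^*\mathfrak{g}^{\mathcal{D}})/G}=0$ is satisfied at $(v_{k-1},r_k,v_k,r_{k+1})$ for all $1\le k\le N-1$. (3) For all sections $\tilde{\xi}\in\Gamma(\mathfrak{g}^{\mathcal{D}})$ and all $1\le k\le N-1$, $$(J_d)_{\tilde{\xi}}(q_k,q_{k+1})-(J_d)_{\tilde{\xi}}(q_{k-1},q_k)=-D_1L_d(q_{k-1},q_k)\big((\tilde{\xi}(q_k)-\tilde{\xi}(q_{k-1}))_Q(q_{k-1})\big).$$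
   Context: All manifolds and maps are smooth. $G$ is a Lie group with Lie algebra $\mathfrak{g}$ and identity $e$, acting on the left, freely and properly on a manifold $Q$ by $l^Q_g(q)$, so that the quotient map $\pi:Q\to Q/G$ is a principal bundle. Notation: $\xi_Q(q)=\frac{d}{dt}\big|_{t=0}l^Q_{\exp(t\xi)}(q)$; $l^{TQ}_g=dl^Q_g$ (lifted action); $l^{Q\times Q}_g(q_0,q_1)=(l^Q_g(q_0),l^Q_g(q_1))$ (diagonal action); $l^G_g(h)=ghg^{-1}$; $\mathcal{V}^G_q=T_q(l^Q_G(\{q\}))$; $D_j$ is differentiation with respect to the $j$-th factor of a Cartesian product; $p_j$ is the projection on the $j$-th factor. Systems. A nonholonomic discrete mechanical system is $(Q,L_d,\mathcal{D},\mathcal{D}_d)$ with $L_d:Q\times Q\to\mathbb{R}$ smooth, $\mathcal{D}$ a subbundle of $TQ$ and $\mathcal{D}_d\subset Q\times Q$ a submanifold. $G$ is a symmetry group of it if $G$ acts on the left, freely and properly on $Q$ by $l^Q$ (so that $\pi:Q\to Q/G$ is a principal bundle), $L_d$ and $\mathcal{D}_d$ are invariant under the diagonal action and $\mathcal{D}$ is invariant under the lifted action. A discrete curve is a map $q_\cdot:\{0,\dots,N\}\to Q$; a variation is $\delta q_\cdot$ with $\delta q_k\in T_{q_k}Q$; it has vanishing end points if $\delta q_0=0$, $\delta q_N=0$; $S_d(q_\cdot)=\sum_{k=0}^{N-1}L_d(q_k,q_{k+1})$. Connection. It is assumed that $\mathcal{S}_q:=\mathcal{V}^G_q\cap\mathcal{D}_q$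 has locally constant rank and that $G$-invariant subbundles $\mathcal{H},\mathcal{U},\mathcal{W}$ of $TQ$ are fixed with $\mathcal{D}=\mathcal{S}\oplus\mathcal{H}$, $\mathcal{V}^G=\mathcal{S}\oplus\mathcal{U}$, $TQ=\mathcal{W}\oplus\mathcal{U}\oplus\mathcal{S}\oplus\mathcal{H}$. $\mathcal{A}$ is the principal connection on $\pi$ with horizontal bundle $\mathcal{W}\oplus\mathcal{H}$. $\mathfrak{g}^{\mathcal{D}}=\{(q,\xi)\in Q\times\mathfrak{g}:\xi_Q(q)\in\mathcal{D}_q\}$, a vector bundle over $Q$. Momentum. The nonholonomic discrete momentum map $J_d:Q\times Q\to(\mathfrak{g}^{\mathcal{D}})^*$ is $J_d(q_0,q_1)(q_0,\xi)=-D_1L_d(q_0,q_1)(\xi_Q(q_0))$ for $(q_0,\xi)\in\mathfrak{g}^{\mathcal{D}}$. A section $\tilde{\xi}$ of $\mathfrak{g}^{\mathcal{D}}$ is identified with its $\mathfrak{g}$-component $\tilde{\xi}(q)\in\mathfrak{g}$, and $(J_d)_{\tilde{\xi}}(q_0,q_1)=J_d(q_0,q_1)(q_0,\tilde{\xi}(q_0))$. Affine discrete connection. Let $\gamma:Q\to G$ be smooth and $G$-equivariant for $l^Q$ and $l^G$, $\Gamma=\{(q,l^Q_{\gamma(q)}(q)):q\in Q\}$, and $Hor\subset Q\times Q$ a $G$-invariant submanifold with $\Gamma\subset Hor$; put $Hor^2(q)=p_2(Hor\cap(\{q\}\times Q))$. $Hor$ defines an affine discrete connection $\mathcal{A}_d$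 of level $\gamma$ if for each $q\in Q$, $Hor^2(q)$ is a submanifold of $Q$ and $T_{q_1}Q=T_{q_1}(l^Q_G(\{q\}))\oplus T_{q_1}Hor^2(q)$ for all $q_1\in l^Q_G(\{q\})\cap Hor^2(q)$. Then there are a $G$-invariant open neighborhood $U$ of $\Gamma$ and an open neighborhood $\mathcal{O}$ of the diagonal in $(Q/G)\times(Q/G)$ such that for all $(q_0,q_1)\in\mathfrak{U}:=(\pi\times\pi)^{-1}(\mathcal{O})$ there is a unique $g\in G$ with $(q_0,l^Q_{g^{-1}}(q_1))\in Hor\cap U$; fix such $U,\mathcal{O}$ and set $\mathcal{A}_d(q_0,q_1):=g$ (discrete connection 1-form, smooth on $\mathfrak{U}$). For $(\pi(q_0),r_1)\in\mathcal{O}$, $\overline{h_d^{q_0}}(r_1)$ is the unique $q_1$ with $\pi(q_1)=r_1$ and $\mathcal{A}_d(q_0,q_1)=e$. Convention: the notation treats $\mathcal{A}_d$ as defined everywhere; all pairs at which $\mathcal{A}_d$ is evaluated (in particular all $(q_k,q_{k+1})$) are assumed to be in $\mathfrak{U}$, and $Q\times G\times(Q/G)$, $\tilde{G}\times(Q/G)$ stand for the open subsets where $(\pi(q_0),r_1)\in\mathcal{O}$. Reduced objects. $\tilde{G}=(Q\times G)/G$ for the action $g\cdot(q,w)=(l^Q_g(q),gwg^{-1})$, with quotient map $\rho:Q\times G\to\tilde{G}$ and $p^{Q/G}(\rho(q,w))=\pi(q)$. $\tilde{F}_1(q_0,w_0,r_1)=l^Q_{w_0}(\overline{h_d^{q_0}}(r_1))$;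 $\check{L}_d(q_0,w_0,r_1)=L_d(q_0,\tilde{F}_1(q_0,w_0,r_1))$. For $\alpha\in T^*_wG$, $\alpha w^{-1}\in\mathfrak{g}^*$ is the right translate: $(\alpha w^{-1})(\xi)=\alpha(dR_w(e)(\xi))$, $R_w$ being right multiplication by $w$. Intrinsic vertical condition. $\check{Q}^{(2)}_G=\{(q_0,w_0,r_1,v_1,r_2)\in Q\times G\times(Q/G)\times\tilde{G}\times(Q/G): p^{Q/G}(v_1)=r_1\}$ with action $g\cdot(q_0,w_0,r_1,v_1,r_2)=(l^Q_g(q_0),l^G_g(w_0),r_1,v_1,r_2)$, and $Q^{(2)}_G=\check{Q}^{(2)}_G/G=\{(v_0,r_1,v_1,r_2):p^{Q/G}(v_1)=r_1\}$. For $(q_0,w_0,r_1,v_1,r_2)\in\check{Q}^{(2)}_G$ let $q_1=F_1(q_0,w_0,r_1,v_1,r_2):=\tilde{F}_1(q_0,w_0,r_1)$, and $w_1\in G$ the unique element with $\rho(q_1,w_1)=v_1$. $\bar{\psi}:(\check{Q}^{(2)}_G\times\mathfrak{g})/G\to\mathbb{R}$ ($G$ acting on $\mathfrak{g}$ by the adjoint action) is the well-defined map $\bar{\psi}([(q_0,w_0,r_1,v_1,r_2,\xi_1)])=\big(D_2\check{L}_d(q_0,w_0,r_1)w_0^{-1}-D_2\check{L}_d(q_1,w_1,r_2)w_1^{-1}\big)(\xi_1)$. The condition $\bar{\psi}|_{(F_1^*\mathfrak{g}^{\mathcal{D}})/G}=0$ at $(v_0,r_1,v_1,r_2)$ says that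 this vanishes, for $(q_0,w_0)\in\rho^{-1}(v_0)$, whenever $(q_1,\xi_1)\in\mathfrak{g}^{\mathcal{D}}$. *)

theory Defs
  imports
    "HOL-Analysis.Analysis"
    "HOL-Algebra.Group_Action"
    "HOL-Library.Function_Algebras"
begin

section \<open>Pointwise scalar multiplication\<close>

text \<open>Tangent vectors are functionals on smooth functions. This instance makes
  \<^const>\<open>span\<close>, \<^const>\<open>subspace\<close>, \<^const>\<open>independent\<close> and \<^const>\<open>dim\<close> available for them.\<close>

instantiation "fun" :: (type, real_vector) real_vector
begin

definition scaleR_fun :: "real \<Rightarrow> ('a \<Rightarrow> 'b) \<Rightarrow> 'a \<Rightarrow> 'b"
  where "scaleR_fun c f = (\<lambda>x. c *\<^sub>R f x)"

instance
  by standard (auto simp: scaleR_fun_def fun_eq_iff algebra_simps)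

end


section \<open>Smooth manifolds\<close>

text \<open>\<open>C\<^sup>k\<close> on an open set of a finite-dimensional space.\<close>

fun C_k_on :: "nat \<Rightarrow> 'a::real_normed_vector set \<Rightarrow> ('a \<Rightarrow> 'b::real_normed_vector) \<Rightarrow> bool"
  where
    "C_k_on 0 U f = continuous_on U f"
  | "C_k_on (Suc k) U f = ((\<forall>x\<in>U. f differentiable (at x)) \<and>
       (\<forall>v. C_k_on k U (\<lambda>x. frechet_derivative f (at x) v)))"

text \<open>Smoothness on an arbitrary subset: local extendability to a smooth function on an open set.
  It is used for relatively open subsets of linear subspaces, where it is smoothness in the
  usual sense.\<close>

definition smooth_on :: "'a::euclidean_space set \<Rightarrow> ('a \<Rightarrow> 'b::euclidean_space) \<Rightarrow> bool"
  where "smooth_on S f \<longleftrightarrow> (\<forall>x\<in>S. \<exists>U g. open U \<and> x \<in> U \<and>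
    (\<forall>k. C_k_on k U g) \<and> (\<forall>y\<in>S \<inter> U. g y = f y))"

type_synonym ('m, 'e) chart = "'m set \<times> ('m \<Rightarrow> 'e)"

text \<open>The model space is a linear subspace \<open>E\<close> of \<^typ>\<open>'e\<close> rather than the whole type: types of
  class \<^class>\<open>euclidean_space\<close> have positive dimension, and dimension zero (for instance a
  discrete group) is not to be excluded.\<close>

definition is_chart :: "'e::euclidean_space set \<Rightarrow> ('m::topological_space, 'e) chart \<Rightarrow> bool"
  where "is_chart E c \<longleftrightarrow> (case c of (U, \<phi>) \<Rightarrow>
    open U \<and> openin (top_of_set E) (\<phi> ` U) \<and> homeomorphism U (\<phi> ` U) \<phi> (inv_into U \<phi>))"

definition compatible_charts :: "('m, 'e::euclidean_space) chart \<Rightarrow> ('m, 'e) chart \<Rightarrow> bool"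
  where "compatible_charts c d \<longleftrightarrow> (case (c, d) of ((U, \<phi>), (V, \<psi>)) \<Rightarrow>
    smooth_on (\<phi> ` (U \<inter> V)) (\<psi> \<circ> inv_into U \<phi>) \<and>
    smooth_on (\<psi> ` (U \<inter> V)) (\<phi> \<circ> inv_into V \<psi>))"

text \<open>The underlying set is a whole type, and the separation and countability axioms come from its
  type class. An atlas need not be maximal.\<close>

definition smooth_manifold ::
    "'e::euclidean_space set \<Rightarrow> ('m::{t2_space,second_countable_topology}, 'e) chart set \<Rightarrow> bool"
  where "smooth_manifold E A \<longleftrightarrow> subspace E \<and> (\<forall>c\<in>A. is_chart E c) \<and>
    (\<Union>c\<in>A. fst c) = UNIV \<and> (\<forall>c\<in>A. \<forall>d\<in>A. compatible_charts c d)"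

definition prod_atlas :: "('m, 'e) chart set \<Rightarrow> ('n, 'f) chart set \<Rightarrow> ('m \<times> 'n, 'e \<times> 'f) chart set"
  where "prod_atlas A B = {(U \<times> V, map_prod \<phi> \<psi>) | U \<phi> V \<psi>. (U, \<phi>) \<in> A \<and> (V, \<psi>) \<in> B}"

definition real_atlas :: "(real, real) chart set"
  where "real_atlas = {(UNIV, id)}"

text \<open>Intended for open \<open>S\<close>.\<close>

definition smooth_map_on ::
    "'m::topological_space set \<Rightarrow> ('m, 'e::euclidean_space) chart set \<Rightarrow>
     ('n, 'f::euclidean_space) chart set \<Rightarrow> ('m \<Rightarrow> 'n) \<Rightarrow> bool"
  where "smooth_map_on S A B f \<longleftrightarrow> (\<forall>x\<in>S. \<exists>(U, \<phi>)\<in>A. \<exists>(V, \<psi>)\<in>B. \<exists>W.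
    open W \<and> x \<in> W \<and> W \<subseteq> S \<inter> U \<and> f ` W \<subseteq> V \<and> smooth_on (\<phi> ` W) (\<psi> \<circ> f \<circ> inv_into U \<phi>))"

abbreviation smooth_map where "smooth_map \<equiv> smooth_map_on UNIV"

abbreviation smooth_fun ::
    "('m::topological_space, 'e::euclidean_space) chart set \<Rightarrow> ('m \<Rightarrow> real) \<Rightarrow> bool"
  where "smooth_fun A f \<equiv> smooth_map A real_atlas f"

text \<open>Embedded submanifolds, by slice charts of the maximal atlas.\<close>

definition submanifold ::
    "'e::euclidean_space set \<Rightarrow> ('m::topological_space, 'e) chart set \<Rightarrow> 'm set \<Rightarrow> bool"
  where "submanifold E A S \<longleftrightarrow> (\<forall>p\<in>S. \<exists>U \<phi> F.
    is_chart E (U, \<phi>) \<and> (\<forall>c\<in>A. compatible_charts (U, \<phi>) c) \<and> p \<in> U \<and>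
    subspace F \<and> F \<subseteq> E \<and> \<phi> ` (U \<inter> S) = \<phi> ` U \<inter> F)"


section \<open>Tangent vectors, vector bundles\<close>

type_synonym 'm tangent = "('m \<Rightarrow> real) \<Rightarrow> real"

text \<open>Derivations at \<open>p\<close> of the algebra of smooth functions. The value outside that algebra is
  fixed to be \<open>0\<close>, so that equality of functionals is equality of derivations.\<close>

definition tangent_space ::
    "('m::topological_space, 'e::euclidean_space) chart set \<Rightarrow> 'm \<Rightarrow> 'm tangent set"
  where "tangent_space A p = {v.
    (\<forall>f g. smooth_fun A f \<longrightarrow> smooth_fun A g \<longrightarrow> v (\<lambda>x. f x + g x) = v f + v g) \<and>
    (\<forall>c f. smooth_fun A f \<longrightarrow> v (\<lambda>x. c * f x) = c * v f) \<and>
    (\<forall>f g. smooth_fun A f \<longrightarrow> smooth_fun A g \<longrightarrow> v (\<lambda>x. f x * g x) = f p * v g + g p * v f) \<and>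
    (\<forall>f. \<not> smooth_fun A f \<longrightarrow> v f = 0)}"

text \<open>The differential \<open>dF\<close>. For real-valued \<open>F\<close> and the identification of the tangent spaces of
  \<open>\<real>\<close> with \<open>\<real>\<close>, \<open>dF(v)\<close> is the number \<open>v F\<close>.\<close>

definition tangent_map ::
    "('m, 'e) chart set \<Rightarrow> ('n::topological_space, 'f::euclidean_space) chart set \<Rightarrow>
     ('m \<Rightarrow> 'n) \<Rightarrow> 'm tangent \<Rightarrow> 'n tangent"
  where "tangent_map A B F v = (\<lambda>f. if smooth_fun B f then v (f \<circ> F) else 0)"

definition velocity ::
    "('m::topological_space, 'e::euclidean_space) chart set \<Rightarrow> (real \<Rightarrow> 'm) \<Rightarrow> real \<Rightarrow> 'm tangent"
  where "velocity A c t = (\<lambda>f. if smooth_fun A f then deriv (f \<circ> c) t else 0)"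

text \<open>The tangent space at \<open>p\<close> of a submanifold \<open>S\<close>, as a subspace of the ambient one.\<close>

definition tangent_subset ::
    "('m::topological_space, 'e::euclidean_space) chart set \<Rightarrow> 'm set \<Rightarrow> 'm \<Rightarrow> 'm tangent set"
  where "tangent_subset A S p = {velocity A c 0 | c. \<exists>\<epsilon>>0.
    smooth_map_on {-\<epsilon><..<\<epsilon>} real_atlas A c \<and> c ` {-\<epsilon><..<\<epsilon>} \<subseteq> S \<and> c 0 = p}"

text \<open>A vector field is smooth iff it maps smooth functions to smooth functions.\<close>

definition smooth_vector_field_on ::
    "'m::topological_space set \<Rightarrow> ('m, 'e::euclidean_space) chart set \<Rightarrow> ('m \<Rightarrow> 'm tangent) \<Rightarrow> bool"
  where "smooth_vector_field_on S A X \<longleftrightarrow> (\<forall>x\<in>S. X x \<in> tangent_space A x) \<and>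
    (\<forall>f. smooth_fun A f \<longrightarrow> smooth_map_on S A real_atlas (\<lambda>x. X x f))"

text \<open>Subbundles of the tangent bundle, given by their fibres; local frames are smooth.\<close>

definition subbundle ::
    "('m::topological_space, 'e::euclidean_space) chart set \<Rightarrow> ('m \<Rightarrow> 'm tangent set) \<Rightarrow> bool"
  where "subbundle A D \<longleftrightarrow> (\<forall>p. \<exists>S (k::nat) X. open S \<and> p \<in> S \<and>
    (\<forall>i<k. smooth_vector_field_on S A (X i)) \<and>
    (\<forall>x\<in>S. inj_on (\<lambda>i. X i x) {..<k} \<and> independent ((\<lambda>i. X i x) ` {..<k}) \<and>
      span ((\<lambda>i. X i x) ` {..<k}) = D x))"

definition locally_constant_rank ::
    "('m::topological_space \<Rightarrow> 'm tangent set) \<Rightarrow> bool"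
  where "locally_constant_rank D \<longleftrightarrow> (\<forall>p. \<exists>S. open S \<and> p \<in> S \<and> (\<forall>x\<in>S. dim (D x) = dim (D p)))"

text \<open>Internal direct sum of a list of subspaces: each vector of \<open>X\<close> is a unique sum.\<close>

definition direct_sum :: "'v::real_vector set \<Rightarrow> 'v set list \<Rightarrow> bool"
  where "direct_sum X Vs \<longleftrightarrow> (\<forall>V\<in>set Vs. subspace V) \<and> bij_betw sum_list (listset Vs) X"


section \<open>Lie groups and their actions\<close>

definition lie_group ::
    "'h::euclidean_space set \<Rightarrow> ('g::{t2_space,second_countable_topology}, 'h) chart set \<Rightarrow>
     'g monoid \<Rightarrow> bool"
  where "lie_group E A G \<longleftrightarrow> group G \<and> carrier G = UNIV \<and> smooth_manifold E A \<and>
    smooth_map (prod_atlas A A) A (\<lambda>(g, h). g \<otimes>\<^bsub>G\<^esub> h) \<and> smooth_map A A (\<lambda>g. inv\<^bsub>G\<^esub> g)"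

abbreviation lie_algebra ::
    "('g::topological_space, 'h::euclidean_space) chart set \<Rightarrow> 'g monoid \<Rightarrow> 'g tangent set"
  where "lie_algebra A G \<equiv> tangent_space A \<one>\<^bsub>G\<^esub>"

text \<open>This determines \<open>ex\<close> on the Lie algebra: \<open>t \<mapsto> ex (t \<xi>)\<close> is the one-parameter subgroup with
  initial velocity \<open>\<xi>\<close>, which exists and is unique in every Lie group.\<close>

definition exponential_map ::
    "('g::topological_space, 'h::euclidean_space) chart set \<Rightarrow> 'g monoid \<Rightarrow> ('g tangent \<Rightarrow> 'g) \<Rightarrow> bool"
  where "exponential_map A G ex \<longleftrightarrow> (\<forall>\<xi>\<in>lie_algebra A G.
    smooth_map real_atlas A (\<lambda>t. ex (t *\<^sub>R \<xi>)) \<and>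
    (\<forall>s t. ex ((s + t) *\<^sub>R \<xi>) = ex (s *\<^sub>R \<xi>) \<otimes>\<^bsub>G\<^esub> ex (t *\<^sub>R \<xi>)) \<and>
    velocity A (\<lambda>t. ex (t *\<^sub>R \<xi>)) 0 = \<xi>)"

definition adjoint ::
    "('g::topological_space, 'h::euclidean_space) chart set \<Rightarrow> 'g monoid \<Rightarrow> 'g \<Rightarrow> 'g tangent \<Rightarrow> 'g tangent"
  where "adjoint A G g = tangent_map A A (\<lambda>h. g \<otimes>\<^bsub>G\<^esub> h \<otimes>\<^bsub>G\<^esub> inv\<^bsub>G\<^esub> g)"

text \<open>The right translate \<open>\<alpha> w\<^sup>-\<^sup>1\<close> of a covector \<open>\<alpha>\<close> at \<open>w\<close>.\<close>

definition right_translate ::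
    "('g::topological_space, 'h::euclidean_space) chart set \<Rightarrow> 'g monoid \<Rightarrow> 'g \<Rightarrow>
     ('g tangent \<Rightarrow> real) \<Rightarrow> 'g tangent \<Rightarrow> real"
  where "right_translate A G w \<alpha> \<xi> = \<alpha> (tangent_map A A (\<lambda>h. h \<otimes>\<^bsub>G\<^esub> w) \<xi>)"

text \<open>Smoothness of a map into the finite-dimensional vector space \<^term>\<open>lie_algebra AG G\<close>; the
  evaluations at smooth functions span its dual.\<close>

definition smooth_algebra_map ::
    "('m::topological_space, 'e::euclidean_space) chart set \<Rightarrow>
     ('g::topological_space, 'h::euclidean_space) chart set \<Rightarrow> 'g monoid \<Rightarrow> ('m \<Rightarrow> 'g tangent) \<Rightarrow> bool"
  where "smooth_algebra_map A AG G \<zeta> \<longleftrightarrow> (\<forall>q. \<zeta> q \<in> lie_algebra AG G) \<and>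
    (\<forall>f. smooth_fun AG f \<longrightarrow> smooth_fun A (\<lambda>q. \<zeta> q f))"

text \<open>Smooth, free and proper left actions.\<close>

definition free_proper_action ::
    "('m::{t2_space,second_countable_topology}, 'e::euclidean_space) chart set \<Rightarrow>
     ('g::{t2_space,second_countable_topology}, 'h::euclidean_space) chart set \<Rightarrow>
     'g monoid \<Rightarrow> ('g \<Rightarrow> 'm \<Rightarrow> 'm) \<Rightarrow> bool"
  where "free_proper_action A AG G l \<longleftrightarrow> group_action G UNIV l \<and>
    smooth_map (prod_atlas AG A) A (\<lambda>(g, q). l g q) \<and>
    (\<forall>g q. l g q = q \<longrightarrow> g = \<one>\<^bsub>G\<^esub>) \<and>
    proper_map euclidean euclidean (\<lambda>(g, q). (l g q, q))"

text \<open>The fundamental vector field \<open>\<xi>\<^sub>Q\<close>.\<close>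

definition generator ::
    "('m::topological_space, 'e::euclidean_space) chart set \<Rightarrow> ('g tangent \<Rightarrow> 'g) \<Rightarrow>
     ('g \<Rightarrow> 'm \<Rightarrow> 'm) \<Rightarrow> 'g tangent \<Rightarrow> 'm \<Rightarrow> 'm tangent"
  where "generator A ex l \<xi> q = velocity A (\<lambda>t. l (ex (t *\<^sub>R \<xi>)) q) 0"

definition vertical ::
    "('m::topological_space, 'e::euclidean_space) chart set \<Rightarrow> 'g monoid \<Rightarrow>
     ('g \<Rightarrow> 'm \<Rightarrow> 'm) \<Rightarrow> 'm \<Rightarrow> 'm tangent set"
  where "vertical A G l q = tangent_subset A (orbit G l q) q"

definition diagonal_action :: "('g \<Rightarrow> 'm \<Rightarrow> 'm) \<Rightarrow> 'g \<Rightarrow> 'm \<times> 'm \<Rightarrow> 'm \<times> 'm"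
  where "diagonal_action l g = (\<lambda>(x, y). (l g x, l g y))"

definition invariant_set :: "('g \<Rightarrow> 'x \<Rightarrow> 'x) \<Rightarrow> 'x set \<Rightarrow> bool"
  where "invariant_set a S \<longleftrightarrow> (\<forall>g. a g ` S = S)"

definition invariant_bundle ::
    "('m::topological_space, 'e::euclidean_space) chart set \<Rightarrow> ('g \<Rightarrow> 'm \<Rightarrow> 'm) \<Rightarrow>
     ('m \<Rightarrow> 'm tangent set) \<Rightarrow> bool"
  where "invariant_bundle A l D \<longleftrightarrow> (\<forall>g q. tangent_map A A (l g) ` D q = D (l g q))"

text \<open>The quotient topology on the orbit space; \<^term>\<open>orbit G l\<close> is the quotient map \<open>\<pi>\<close>.\<close>

definition orbit_topology :: "'g monoid \<Rightarrow> ('g \<Rightarrow> 'm::topological_space \<Rightarrow> 'm) \<Rightarrow> 'm set topology"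
  where "orbit_topology G l =
    topology (\<lambda>V. V \<subseteq> orbits G UNIV l \<and> open {q. orbit G l q \<in> V})"


section \<open>Nonholonomic discrete mechanical systems\<close>

definition nonholonomic_system ::
    "'e::euclidean_space set \<Rightarrow> ('q::{t2_space,second_countable_topology}, 'e) chart set \<Rightarrow>
     ('q \<times> 'q \<Rightarrow> real) \<Rightarrow> ('q \<Rightarrow> 'q tangent set) \<Rightarrow> ('q \<times> 'q) set \<Rightarrow> bool"
  where "nonholonomic_system E A L D Dd \<longleftrightarrow> smooth_manifold E A \<and>
    smooth_fun (prod_atlas A A) L \<and> subbundle A D \<and> submanifold (E \<times> E) (prod_atlas A A) Dd"

definition symmetry_group ::
    "('q::{t2_space,second_countable_topology}, 'e::euclidean_space) chart set \<Rightarrow>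
     ('q \<times> 'q \<Rightarrow> real) \<Rightarrow> ('q \<Rightarrow> 'q tangent set) \<Rightarrow> ('q \<times> 'q) set \<Rightarrow>
     ('g::{t2_space,second_countable_topology}, 'h::euclidean_space) chart set \<Rightarrow> 'g monoid \<Rightarrow>
     ('g \<Rightarrow> 'q \<Rightarrow> 'q) \<Rightarrow> bool"
  where "symmetry_group A L D Dd AG G l \<longleftrightarrow> free_proper_action A AG G l \<and>
    (\<forall>g z. L (diagonal_action l g z) = L z) \<and>
    invariant_set (diagonal_action l) Dd \<and> invariant_bundle A l D"

text \<open>Under the identification of the tangent space of \<open>Q\<^sup>N\<^sup>+\<^sup>1\<close> at a discrete curve with the product
  of the tangent spaces at its points, \<open>dS\<^sub>d\<close> is the sum of the partial differentials. Only the
  values of \<open>q\<close> at \<open>0, \<dots>, N\<close> matter.\<close>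

definition action_sum :: "('q \<times> 'q \<Rightarrow> real) \<Rightarrow> nat \<Rightarrow> (nat \<Rightarrow> 'q) \<Rightarrow> real"
  where "action_sum L N q = (\<Sum>k<N. L (q k, q (Suc k)))"

definition d_action_sum ::
    "('q \<times> 'q \<Rightarrow> real) \<Rightarrow> nat \<Rightarrow> (nat \<Rightarrow> 'q) \<Rightarrow> (nat \<Rightarrow> 'q tangent) \<Rightarrow> real"
  where "d_action_sum L N q \<delta> = (\<Sum>k\<le>N. \<delta> k (\<lambda>x. action_sum L N (q(k := x))))"

text \<open>\<open>D\<^sub>1L\<^sub>d(q\<^sub>0,q\<^sub>1)\<close>.\<close>

definition D1 :: "('q \<times> 'q \<Rightarrow> real) \<Rightarrow> 'q \<Rightarrow> 'q \<Rightarrow> 'q tangent \<Rightarrow> real"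
  where "D1 L q0 q1 v = v (\<lambda>x. L (x, q1))"

text \<open>The fibre over \<open>q\<close> of the bundle \<open>\<gg>\<^sup>D\<close>.\<close>

definition algebra_bundle ::
    "('q::topological_space, 'e::euclidean_space) chart set \<Rightarrow>
     ('g::topological_space, 'h::euclidean_space) chart set \<Rightarrow> 'g monoid \<Rightarrow> ('g tangent \<Rightarrow> 'g) \<Rightarrow>
     ('g \<Rightarrow> 'q \<Rightarrow> 'q) \<Rightarrow> ('q \<Rightarrow> 'q tangent set) \<Rightarrow> 'q \<Rightarrow> 'g tangent set"
  where "algebra_bundle A AG G ex l D q = {\<xi> \<in> lie_algebra AG G. generator A ex l \<xi> q \<in> D q}"

definition algebra_section ::
    "('q::topological_space, 'e::euclidean_space) chart set \<Rightarrow>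
     ('g::topological_space, 'h::euclidean_space) chart set \<Rightarrow> 'g monoid \<Rightarrow> ('g tangent \<Rightarrow> 'g) \<Rightarrow>
     ('g \<Rightarrow> 'q \<Rightarrow> 'q) \<Rightarrow> ('q \<Rightarrow> 'q tangent set) \<Rightarrow> ('q \<Rightarrow> 'g tangent) \<Rightarrow> bool"
  where "algebra_section A AG G ex l D \<zeta> \<longleftrightarrow> smooth_algebra_map A AG G \<zeta> \<and>
    (\<forall>q. \<zeta> q \<in> algebra_bundle A AG G ex l D q)"

text \<open>\<open>J\<^sub>d(q\<^sub>0,q\<^sub>1)\<close>, meaningful on the fibre of \<open>\<gg>\<^sup>D\<close> over \<open>q\<^sub>0\<close>, and \<open>(J\<^sub>d)\<^sub>\<zeta>\<close>.\<close>

definition momentum ::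
    "('q::topological_space, 'e::euclidean_space) chart set \<Rightarrow> ('g tangent \<Rightarrow> 'g) \<Rightarrow>
     ('g \<Rightarrow> 'q \<Rightarrow> 'q) \<Rightarrow> ('q \<times> 'q \<Rightarrow> real) \<Rightarrow> 'q \<Rightarrow> 'q \<Rightarrow> 'g tangent \<Rightarrow> real"
  where "momentum A ex l L q0 q1 \<xi> = - D1 L q0 q1 (generator A ex l \<xi> q0)"

definition momentum_section ::
    "('q::topological_space, 'e::euclidean_space) chart set \<Rightarrow> ('g tangent \<Rightarrow> 'g) \<Rightarrow>
     ('g \<Rightarrow> 'q \<Rightarrow> 'q) \<Rightarrow> ('q \<times> 'q \<Rightarrow> real) \<Rightarrow> ('q \<Rightarrow> 'g tangent) \<Rightarrow> 'q \<Rightarrow> 'q \<Rightarrow> real"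
  where "momentum_section A ex l L \<zeta> q0 q1 = momentum A ex l L q0 q1 (\<zeta> q0)"


section \<open>Connections\<close>

text \<open>\<open>Hz\<close> is the horizontal bundle.\<close>

definition principal_connection ::
    "('q::topological_space, 'e::euclidean_space) chart set \<Rightarrow>
     ('g::topological_space, 'h::euclidean_space) chart set \<Rightarrow> 'g monoid \<Rightarrow> ('g tangent \<Rightarrow> 'g) \<Rightarrow>
     ('g \<Rightarrow> 'q \<Rightarrow> 'q) \<Rightarrow> ('q \<Rightarrow> 'q tangent set) \<Rightarrow> ('q \<Rightarrow> 'q tangent \<Rightarrow> 'g tangent) \<Rightarrow> bool"
  where "principal_connection A AG G ex l Hz \<A> \<longleftrightarrow>
    (\<forall>q. \<forall>v\<in>tangent_space A q. \<A> q v \<in> lie_algebra AG G) \<and>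
    (\<forall>q. \<forall>u\<in>tangent_space A q. \<forall>v\<in>tangent_space A q. \<A> q (u + v) = \<A> q u + \<A> q v) \<and>
    (\<forall>q c. \<forall>v\<in>tangent_space A q. \<A> q (c *\<^sub>R v) = c *\<^sub>R \<A> q v) \<and>
    (\<forall>X. smooth_vector_field_on UNIV A X \<longrightarrow> smooth_algebra_map A AG G (\<lambda>q. \<A> q (X q))) \<and>
    (\<forall>q. \<forall>\<xi>\<in>lie_algebra AG G. \<A> q (generator A ex l \<xi> q) = \<xi>) \<and>
    (\<forall>g q. \<forall>v\<in>tangent_space A q.
      \<A> (l g q) (tangent_map A A (l g) v) = adjoint AG G g (\<A> q v)) \<and>
    (\<forall>q. {v \<in> tangent_space A q. \<A> q v = 0} = Hz q)"

definition level_graph :: "('g \<Rightarrow> 'q \<Rightarrow> 'q) \<Rightarrow> ('q \<Rightarrow> 'g) \<Rightarrow> ('q \<times> 'q) set"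
  where "level_graph l \<gamma> = {(q, l (\<gamma> q) q) | q. True}"

definition Hor2 :: "('q \<times> 'q) set \<Rightarrow> 'q \<Rightarrow> 'q set"
  where "Hor2 Hor q = snd ` (Hor \<inter> {q} \<times> UNIV)"

definition affine_discrete_connection ::
    "'e::euclidean_space set \<Rightarrow> ('q::topological_space, 'e) chart set \<Rightarrow>
     ('g::topological_space, 'h::euclidean_space) chart set \<Rightarrow> 'g monoid \<Rightarrow> ('g \<Rightarrow> 'q \<Rightarrow> 'q) \<Rightarrow>
     ('q \<Rightarrow> 'g) \<Rightarrow> ('q \<times> 'q) set \<Rightarrow> bool"
  where "affine_discrete_connection E A AG G l \<gamma> Hor \<longleftrightarrow>
    smooth_map A AG \<gamma> \<and> (\<forall>g q. \<gamma> (l g q) = g \<otimes>\<^bsub>G\<^esub> \<gamma> q \<otimes>\<^bsub>G\<^esub> inv\<^bsub>G\<^esub> g) \<and>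
    submanifold (E \<times> E) (prod_atlas A A) Hor \<and> invariant_set (diagonal_action l) Hor \<and>
    level_graph l \<gamma> \<subseteq> Hor \<and>
    (\<forall>q. submanifold E A (Hor2 Hor q) \<and>
      (\<forall>q1 \<in> orbit G l q \<inter> Hor2 Hor q. direct_sum (tangent_space A q1)
        [tangent_subset A (orbit G l q) q1, tangent_subset A (Hor2 Hor q) q1]))"

text \<open>The set \<open>\<UU> = (\<pi> \<times> \<pi>)\<^sup>-\<^sup>1(\<O>)\<close>.\<close>

definition connection_domain ::
    "'g monoid \<Rightarrow> ('g \<Rightarrow> 'q \<Rightarrow> 'q) \<Rightarrow> ('q set \<times> 'q set) set \<Rightarrow> ('q \<times> 'q) set"
  where "connection_domain G l \<O> = {(x, y). (orbit G l x, orbit G l y) \<in> \<O>}"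

text \<open>The discrete connection form \<open>\<A>\<^sub>d\<close>, meaningful on \<^term>\<open>connection_domain G l \<O>\<close>.\<close>

definition discrete_connection_form ::
    "'g monoid \<Rightarrow> ('g \<Rightarrow> 'q \<Rightarrow> 'q) \<Rightarrow> ('q \<times> 'q) set \<Rightarrow> ('q \<times> 'q) set \<Rightarrow> 'q \<Rightarrow> 'q \<Rightarrow> 'g"
  where "discrete_connection_form G l Hor U q0 q1 = (THE g. (q0, l (inv\<^bsub>G\<^esub> g) q1) \<in> Hor \<inter> U)"

text \<open>Admissible choices of the neighbourhoods \<open>U\<close> of \<open>\<Gamma>\<close> and \<open>\<O>\<close> of the diagonal.\<close>

definition connection_neighbourhoods ::
    "('q::topological_space, 'e::euclidean_space) chart set \<Rightarrow>
     ('g::topological_space, 'h::euclidean_space) chart set \<Rightarrow> 'g monoid \<Rightarrow> ('g \<Rightarrow> 'q \<Rightarrow> 'q) \<Rightarrow>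
     ('q \<Rightarrow> 'g) \<Rightarrow> ('q \<times> 'q) set \<Rightarrow> ('q \<times> 'q) set \<Rightarrow> ('q set \<times> 'q set) set \<Rightarrow> bool"
  where "connection_neighbourhoods A AG G l \<gamma> Hor U \<O> \<longleftrightarrow>
    open U \<and> invariant_set (diagonal_action l) U \<and> level_graph l \<gamma> \<subseteq> U \<and>
    openin (prod_topology (orbit_topology G l) (orbit_topology G l)) \<O> \<and>
    (\<forall>r \<in> orbits G UNIV l. (r, r) \<in> \<O>) \<and>
    (\<forall>(q0, q1) \<in> connection_domain G l \<O>. \<exists>!g. (q0, l (inv\<^bsub>G\<^esub> g) q1) \<in> Hor \<inter> U) \<and>
    smooth_map_on (connection_domain G l \<O>) (prod_atlas A A) AG
      (\<lambda>(q0, q1). discrete_connection_form G l Hor U q0 q1)"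

text \<open>In the following, \<open>\<A>d\<close> stands for the discrete connection form.
  The horizontal lift \<open>h\<^sub>d\<close> is meaningful if \<open>(\<pi>(q\<^sub>0), r\<^sub>1) \<in> \<O>\<close>.\<close>

definition discrete_lift ::
    "'g monoid \<Rightarrow> ('g \<Rightarrow> 'q \<Rightarrow> 'q) \<Rightarrow> ('q \<Rightarrow> 'q \<Rightarrow> 'g) \<Rightarrow> 'q \<Rightarrow> 'q set \<Rightarrow> 'q"
  where "discrete_lift G l \<A>d q0 r1 = (THE q1. orbit G l q1 = r1 \<and> \<A>d q0 q1 = \<one>\<^bsub>G\<^esub>)"


section \<open>Reduced objects and the intrinsic vertical condition\<close>

text \<open>The quotient map \<open>\<rho>\<close>.\<close>

definition rho :: "'g monoid \<Rightarrow> ('g \<Rightarrow> 'q \<Rightarrow> 'q) \<Rightarrow> 'q \<Rightarrow> 'g \<Rightarrow> ('q \<times> 'g) set"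
  where "rho G l q w = orbit G (\<lambda>g (x, h). (l g x, g \<otimes>\<^bsub>G\<^esub> h \<otimes>\<^bsub>G\<^esub> inv\<^bsub>G\<^esub> g)) (q, w)"

definition F1 ::
    "'g monoid \<Rightarrow> ('g \<Rightarrow> 'q \<Rightarrow> 'q) \<Rightarrow> ('q \<Rightarrow> 'q \<Rightarrow> 'g) \<Rightarrow> 'q \<Rightarrow> 'g \<Rightarrow> 'q set \<Rightarrow> 'q"
  where "F1 G l \<A>d q0 w0 r1 = l w0 (discrete_lift G l \<A>d q0 r1)"

definition check_L ::
    "'g monoid \<Rightarrow> ('g \<Rightarrow> 'q \<Rightarrow> 'q) \<Rightarrow> ('q \<Rightarrow> 'q \<Rightarrow> 'g) \<Rightarrow> ('q \<times> 'q \<Rightarrow> real) \<Rightarrow>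
     'q \<Rightarrow> 'g \<Rightarrow> 'q set \<Rightarrow> real"
  where "check_L G l \<A>d L q0 w0 r1 = L (q0, F1 G l \<A>d q0 w0 r1)"

text \<open>The covector \<open>D\<^sub>2\<close> of \<^const>\<open>check_L\<close> at \<open>w\<close>; the point \<open>w\<close> itself is
  carried by the tangent vector \<open>\<eta>\<close> at \<open>w\<close>.\<close>

definition D2_check_L ::
    "'g monoid \<Rightarrow> ('g \<Rightarrow> 'q \<Rightarrow> 'q) \<Rightarrow> ('q \<Rightarrow> 'q \<Rightarrow> 'g) \<Rightarrow> ('q \<times> 'q \<Rightarrow> real) \<Rightarrow>
     'q \<Rightarrow> 'q set \<Rightarrow> 'g tangent \<Rightarrow> real"
  where "D2_check_L G l \<A>d L q0 r1 \<eta> = \<eta> (\<lambda>w. check_L G l \<A>d L q0 w r1)"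

type_synonym ('q, 'g) reduced_tuple =
  "'q \<times> 'g \<times> 'q set \<times> ('q \<times> 'g) set \<times> 'q set \<times> 'g tangent"

definition psi_check ::
    "('g::topological_space, 'h::euclidean_space) chart set \<Rightarrow> 'g monoid \<Rightarrow> ('g \<Rightarrow> 'q \<Rightarrow> 'q) \<Rightarrow>
     ('q \<Rightarrow> 'q \<Rightarrow> 'g) \<Rightarrow> ('q \<times> 'q \<Rightarrow> real) \<Rightarrow> ('q, 'g) reduced_tuple \<Rightarrow> real"
  where "psi_check AG G l \<A>d L = (\<lambda>(q0, w0, r1, v1, r2, \<xi>1).
    (let q1 = F1 G l \<A>d q0 w0 r1; w1 = (THE w. rho G l q1 w = v1) in
      right_translate AG G w0 (D2_check_L G l \<A>d L q0 r1) \<xi>1 -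
      right_translate AG G w1 (D2_check_L G l \<A>d L q1 r2) \<xi>1))"

definition tuple_action ::
    "('g::topological_space, 'h::euclidean_space) chart set \<Rightarrow> 'g monoid \<Rightarrow> ('g \<Rightarrow> 'q \<Rightarrow> 'q) \<Rightarrow>
     'g \<Rightarrow> ('q, 'g) reduced_tuple \<Rightarrow> ('q, 'g) reduced_tuple"
  where "tuple_action AG G l g = (\<lambda>(q0, w0, r1, v1, r2, \<xi>1).
    (l g q0, g \<otimes>\<^bsub>G\<^esub> w0 \<otimes>\<^bsub>G\<^esub> inv\<^bsub>G\<^esub> g, r1, v1, r2, adjoint AG G g \<xi>1))"

text \<open>The value on a class is the common value of \<^const>\<open>psi_check\<close> on its representatives.\<close>

definition psi_bar ::
    "('g::topological_space, 'h::euclidean_space) chart set \<Rightarrow> 'g monoid \<Rightarrow> ('g \<Rightarrow> 'q \<Rightarrow> 'q) \<Rightarrow>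
     ('q \<Rightarrow> 'q \<Rightarrow> 'g) \<Rightarrow> ('q \<times> 'q \<Rightarrow> real) \<Rightarrow> ('q, 'g) reduced_tuple set \<Rightarrow> real"
  where "psi_bar AG G l \<A>d L C = (THE y. \<forall>z\<in>C. psi_check AG G l \<A>d L z = y)"

definition vertical_condition ::
    "('q::topological_space, 'e::euclidean_space) chart set \<Rightarrow>
     ('g::topological_space, 'h::euclidean_space) chart set \<Rightarrow> 'g monoid \<Rightarrow> ('g tangent \<Rightarrow> 'g) \<Rightarrow>
     ('g \<Rightarrow> 'q \<Rightarrow> 'q) \<Rightarrow> ('q \<Rightarrow> 'q tangent set) \<Rightarrow> ('q \<Rightarrow> 'q \<Rightarrow> 'g) \<Rightarrow> ('q \<times> 'q \<Rightarrow> real) \<Rightarrow>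
     ('q \<times> 'g) set \<Rightarrow> 'q set \<Rightarrow> ('q \<times> 'g) set \<Rightarrow> 'q set \<Rightarrow> bool"
  where "vertical_condition A AG G ex l D \<A>d L v0 r1 v1 r2 \<longleftrightarrow>
    (\<forall>q0 w0 \<xi>1. rho G l q0 w0 = v0 \<longrightarrow>
      \<xi>1 \<in> algebra_bundle A AG G ex l D (F1 G l \<A>d q0 w0 r1) \<longrightarrow>
      psi_bar AG G l \<A>d L (orbit G (tuple_action AG G l) (q0, w0, r1, v1, r2, \<xi>1)) = 0)"

end

theory Submission
  imports Defs
begin

text \<open>
Each of the three conditions says that, at every interior time \<open>k\<close>, the \<^emph>\<open>vertical defect\<close>
\<open>D\<^sub>2L(q\<^bsub>k-1\<^esub>, q\<^sub>k)(\<xi>\<^sub>Q(q\<^sub>k)) + D\<^sub>1L(q\<^sub>k, q\<^bsub>k+1\<^esub>)(\<xi>\<^sub>Q(q\<^sub>k))\<close> vanishes for all \<open>\<xi>\<close> in the fibre of \<open>\<gg>\<^sup>D\<close> over \<open>q\<^sub>k\<close>.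

For (1), independent variations at each time show that the principle is the vanishing of this sum on
the vectors of \<open>\<S>\<close> at \<open>q\<^sub>k\<close>, and these are exactly the generators \<open>\<xi>\<^sub>Q\<close> with \<open>\<xi>\<close> in \<open>\<gg>\<^sup>D\<close>. That every vertical vector
is a generator follows algebraically from the principal connection: a vertical vector minus the
generator of its connection value is vertical and horizontal, hence zero.

For (2), right translation by \<open>w = \<A>\<^sub>d(q\<^sub>0, q\<^sub>1)\<close> identifies the derivative of the reduced Lagrangian in the
group variable with the derivative of \<open>L(q\<^sub>0, h q\<^sub>1)\<close> in \<open>h\<close> at the identity. Differentiating the
invariance \<open>L(q\<^sub>1, h q\<^sub>2) = L(h\<^sup>-\<^sup>1 q\<^sub>1, q\<^sub>2)\<close> shows that \<open>\<psi>\<close> is the vertical defect, and its equivariance under the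
diagonal action makes the value independent of the representative.

For (3), the same infinitesimal invariance and the linearity of \<open>\<xi> \<mapsto> \<xi>\<^sub>Q\<close> reduce the momentum equation
for a section to the vanishing of the defect at the value of the section at \<open>q\<^sub>k\<close>. Conversely every
element of a fibre of \<open>\<gg>\<^sup>D\<close> is the value of a global smooth section: extend its generator to a section
of \<open>D\<close> by a local frame and a bump function, and apply the connection form, which discards the
horizontal component.

The calculus that this needs comprises the closure of \<open>C\<^sup>k\<close> maps under composition, composition and
chart independence of smooth maps between manifolds, and the existence of smooth bump functions.
\<close>

section \<open>Calculus of \<open>C\<^sup>k\<close> maps\<close>

lemma C_k_on_subset: "C_k_on k U f \<Longrightarrow> V \<subseteq> U \<Longrightarrow> C_k_on k V f"
  by (induction k arbitrary: f) (auto intro: continuous_on_subset)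

lemma C_k_on_cong:
  assumes "open U" "\<And>x. x \<in> U \<Longrightarrow> f x = g x" "C_k_on k U f"
  shows "C_k_on k U g"
  using assms(2,3)
proof (induction k arbitrary: f g)
  case 0
  then show ?case by (auto cong: continuous_on_cong_simp)
next
  case (Suc k)
  have g: "(g has_derivative frechet_derivative f (at x)) (at x)" if "x \<in> U" for x
    using Suc.prems that
    by (auto intro: has_derivative_transform_within_open[OF _ assms(1)] simp: frechet_derivative_works)
  have "C_k_on k U (\<lambda>x. frechet_derivative g (at x) v)" for v
  proof (rule Suc.IH)
    show "C_k_on k U (\<lambda>x. frechet_derivative f (at x) v)" using Suc.prems by simp
    show "frechet_derivative f (at x) v = frechet_derivative g (at x) v" if "x \<in> U" for x
      using frechet_derivative_at[OF g[OF that]] by simp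
  qed
  then show ?case using g by (auto simp: differentiable_def)
qed

text \<open>The inductive step of the closure properties below: derivatives are unique on an open set, so that
any explicit family of derivatives may replace the one chosen by \<^const>\<open>frechet_derivative\<close>.\<close>

lemma C_k_on_SucI:
  assumes "open U" "\<And>x. x \<in> U \<Longrightarrow> (f has_derivative f' x) (at x)"
    and "\<And>v. C_k_on k U (\<lambda>x. f' x v)"
  shows "C_k_on (Suc k) U f"
proof -
  have "C_k_on k U (\<lambda>x. frechet_derivative f (at x) v)" for v
    by (rule C_k_on_cong[OF assms(1) _ assms(3)[of v]]) (simp add: frechet_derivative_at[OF assms(2), symmetric])
  then show ?thesis using assms(2) by (auto simp: differentiable_def)
qed

lemma C_k_on_derivative:
  "C_k_on (Suc k) U f \<Longrightarrow> x \<in> U \<Longrightarrow> (f has_derivative frechet_derivative f (at x)) (at x)"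
  by (auto simp: frechet_derivative_works)

lemma C_k_on_Suc_D: "C_k_on (Suc k) U f \<Longrightarrow> C_k_on k U f"
proof (induction k arbitrary: f)
  case 0
  then show ?case
    by (auto intro!: differentiable_imp_continuous_on differentiable_at_imp_differentiable_on)
next
  case (Suc k)
  then show ?case by (metis C_k_on.simps(2))
qed

lemma C_k_on_const: "open U \<Longrightarrow> C_k_on k U (\<lambda>x. c)"
proof (induction k arbitrary: c)
  case (Suc k)
  show ?case
    by (rule C_k_on_SucI[OF Suc.prems has_derivative_const Suc.IH[OF Suc.prems]])
qed auto

lemma C_k_on_linear: "open U \<Longrightarrow> bounded_linear f \<Longrightarrow> C_k_on k U f"
proof (cases k)
  case 0
  then show "bounded_linear f \<Longrightarrow> ?thesis" by (auto intro: linear_continuous_on)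
next
  case (Suc m)
  assume "open U" "bounded_linear f"
  then show ?thesis unfolding Suc
    by (intro C_k_on_SucI[where f' = "\<lambda>_. f"] C_k_on_const bounded_linear_imp_has_derivative)
qed

lemma C_k_on_add:
  "open U \<Longrightarrow> C_k_on k U f \<Longrightarrow> C_k_on k U g \<Longrightarrow> C_k_on k U (\<lambda>x. f x + g x)"
proof (induction k arbitrary: f g)
  case (Suc k)
  show ?case
    by (rule C_k_on_SucI[OF Suc.prems(1) has_derivative_add[OF Suc.prems(2,3)[THEN C_k_on_derivative]]])
      (use Suc in \<open>auto\<close>)
qed (auto intro: continuous_on_add)

lemma C_k_on_sum:
  "open U \<Longrightarrow> (\<And>i. i \<in> I \<Longrightarrow> C_k_on k U (f i)) \<Longrightarrow> C_k_on k U (\<lambda>x. \<Sum>i\<in>I. f i x)"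
  by (induction I rule: infinite_finite_induct) (auto intro: C_k_on_add C_k_on_const)

lemma (in bounded_bilinear) C_k_on_prod:
  "open U \<Longrightarrow> C_k_on k U f \<Longrightarrow> C_k_on k U g \<Longrightarrow> C_k_on k U (\<lambda>x. prod (f x) (g x))"
proof (induction k arbitrary: f g)
  case (Suc k)
  note fg = Suc.prems(2,3)[THEN C_k_on_Suc_D]
  show ?case
    by (rule C_k_on_SucI[OF Suc.prems(1) FDERIV[OF Suc.prems(2,3)[THEN C_k_on_derivative]]])
      (use Suc.prems in \<open>auto intro!: C_k_on_add Suc.IH fg\<close>)
qed (auto intro: continuous_on)

text \<open>The chain rule writes a directional derivative of the composite as
\<open>\<Sum>\<^sub>b (f'(x) v \<bullet> b) g'(f x) b\<close> over a basis, which is a sum of products of maps of one order less;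
the induction is over the order, with the outer map arbitrary.\<close>

lemma C_k_on_compose:
  fixes f :: "'a::real_normed_vector \<Rightarrow> 'b::euclidean_space"
  shows "open U \<Longrightarrow> open V \<Longrightarrow> f ` U \<subseteq> V \<Longrightarrow> C_k_on k U f \<Longrightarrow> C_k_on k V g \<Longrightarrow> C_k_on k U (g \<circ> f)"
proof (induction k arbitrary: g)
  case 0
  then show ?case by (auto simp: o_def intro: continuous_on_compose2)
next
  case (Suc k)
  let ?f' = "\<lambda>x. frechet_derivative f (at x)" and ?g' = "\<lambda>y. frechet_derivative g (at y)"
  have g: "(g has_derivative ?g' (f x)) (at (f x))" if "x \<in> U" for x
    using C_k_on_derivative[OF Suc.prems(5), of "f x"] that Suc.prems(3) by auto
  have "?g' (f x) w = (\<Sum>b\<in>Basis. (w \<bullet> b) *\<^sub>R ?g' (f x) b)" if "x \<in> U" for x w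
  proof -
    interpret linear "?g' (f x)" using g[OF that] by (rule has_derivative_linear)
    show ?thesis using sum[of "\<lambda>b. (w \<bullet> b) *\<^sub>R b" Basis] by (simp add: euclidean_representation scale)
  qed
  then have "((g \<circ> f) has_derivative (\<lambda>v. \<Sum>b\<in>Basis. (?f' x v \<bullet> b) *\<^sub>R ?g' (f x) b)) (at x)" if "x \<in> U" for x
    using diff_chain_at[OF C_k_on_derivative[OF Suc.prems(4) that] g[OF that]] that by (simp add: o_def)
  then show ?case
  proof (rule C_k_on_SucI[OF Suc.prems(1)], goal_cases)
    case (2 v)
    have "C_k_on k U (\<lambda>x. ?g' (f x) b)" for b
      using Suc.IH[OF Suc.prems(1-3) C_k_on_Suc_D[OF Suc.prems(4)], of "\<lambda>y. ?g' y b"] Suc.prems(5)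
      by (simp add: o_def)
    moreover have "C_k_on k U (\<lambda>x. ?f' x v \<bullet> b)" for b
      using Suc.prems(4)
      by (auto intro!: bounded_bilinear.C_k_on_prod[OF bounded_bilinear_inner] Suc.prems C_k_on_const)
    ultimately show ?case
      by (auto intro!: C_k_on_sum bounded_bilinear.C_k_on_prod[OF bounded_bilinear_scaleR] Suc.prems)
  qed
qed

lemma C_k_on_Pair:
  fixes f :: "'a::real_normed_vector \<Rightarrow> 'b::real_normed_vector" and g :: "'a \<Rightarrow> 'c::real_normed_vector"
  shows "open U \<Longrightarrow> C_k_on k U f \<Longrightarrow> C_k_on k U g \<Longrightarrow> C_k_on k U (\<lambda>x. (f x, g x))"
proof (induction k arbitrary: f g)
  case (Suc k)
  show ?case
    by (rule C_k_on_SucI[OF Suc.prems(1) has_derivative_Pair[OF Suc.prems(2,3)[THEN C_k_on_derivative]]])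
      (use Suc in auto)
qed (auto intro: continuous_on_Pair)

section \<open>Smoothness on arbitrary subsets\<close>

lemma smooth_onI:
  "(\<And>x. x \<in> S \<Longrightarrow> \<exists>U g. open U \<and> x \<in> U \<and> (\<forall>k. C_k_on k U g) \<and> (\<forall>y\<in>S \<inter> U. g y = f y))
    \<Longrightarrow> smooth_on S f"
  by (simp add: smooth_on_def)

lemma smooth_onE:
  assumes "smooth_on S f" "x \<in> S"
  obtains U g where "open U" "x \<in> U" "\<And>k. C_k_on k U g" "\<And>y. y \<in> S \<Longrightarrow> y \<in> U \<Longrightarrow> g y = f y"
  using bspec[OF assms(1)[unfolded smooth_on_def] assms(2)] by (elim exE conjE) (use that in auto)

lemma C_k_on_imp_smooth_on: "(\<And>k. C_k_on k UNIV f) \<Longrightarrow> smooth_on S f"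
  unfolding smooth_on_def by (intro ballI exI[of _ UNIV] exI[of _ f]) auto

lemma smooth_on_subset: "smooth_on S f \<Longrightarrow> T \<subseteq> S \<Longrightarrow> smooth_on T f"
proof (rule smooth_onI)
  fix x assume S: "smooth_on S f" and T: "T \<subseteq> S" and x: "x \<in> T"
  then have "x \<in> S" by auto
  from S this obtain U g where "open U" "x \<in> U" "\<And>k. C_k_on k U g" "\<And>y. y \<in> S \<Longrightarrow> y \<in> U \<Longrightarrow> g y = f y"
    by (rule smooth_onE) blast
  then show "\<exists>U g. open U \<and> x \<in> U \<and> (\<forall>k. C_k_on k U g) \<and> (\<forall>y\<in>T \<inter> U. g y = f y)"
    using T by (intro exI[of _ U] exI[of _ g]) auto
qed

lemma smooth_on_cong: "smooth_on S f \<Longrightarrow> (\<And>x. x \<in> S \<Longrightarrow> f x = g x) \<Longrightarrow> smooth_on S g"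
proof (rule smooth_onI)
  fix x assume S: "smooth_on S f" and eq: "\<And>x. x \<in> S \<Longrightarrow> f x = g x" and x: "x \<in> S"
  from S x obtain U h where "open U" "x \<in> U" "\<And>k. C_k_on k U h" "\<And>y. y \<in> S \<Longrightarrow> y \<in> U \<Longrightarrow> h y = f y"
    by (rule smooth_onE) blast
  then show "\<exists>U h. open U \<and> x \<in> U \<and> (\<forall>k. C_k_on k U h) \<and> (\<forall>y\<in>S \<inter> U. h y = g y)"
    using eq by (intro exI[of _ U] exI[of _ h]) auto
qed

lemma smooth_on_imp_continuous_on: "smooth_on S f \<Longrightarrow> continuous_on S f"
  unfolding continuous_on_eq_continuous_within
proof
  fix x assume S: "smooth_on S f" and x: "x \<in> S"
  obtain U g where U: "open U" "x \<in> U" and Ck: "\<And>k. C_k_on k U g"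
    and g: "\<And>y. y \<in> S \<Longrightarrow> y \<in> U \<Longrightarrow> g y = f y"
    using smooth_onE[OF S x] by blast
  have "continuous_on (S \<inter> U) f"
    using g Ck[of 0] by (auto intro: continuous_on_eq[of _ g] continuous_on_subset)
  then have "continuous (at x within S \<inter> U) f" using x U by (simp add: continuous_on_eq_continuous_within)
  then show "continuous (at x within S) f"
    using at_within_nhd[OF U(2,1), of "S \<inter> U" S] by auto
qed

text \<open>Local extensions compose once the extension of the inner map is restricted to the open set on which
it takes values in the domain of the extension of the outer one.\<close>

lemma smooth_on_compose:
  assumes "smooth_on S f" "smooth_on T g" "f ` S \<subseteq> T"
  shows "smooth_on S (g \<circ> f)"
proof (rule smooth_onI)
  fix x assume x: "x \<in> S"
  obtain U f' where U: "open U" "x \<in> U" "\<And>k. C_k_on k U f'" "\<And>y. y \<in> S \<Longrightarrow> y \<in> U \<Longrightarrow> f' y = f y"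
    using smooth_onE[OF assms(1) x] by blast
  obtain V g' where V: "open V" "f x \<in> V" "\<And>k. C_k_on k V g'" "\<And>y. y \<in> T \<Longrightarrow> y \<in> V \<Longrightarrow> g' y = g y"
    using smooth_onE[OF assms(2), of "f x"] x assms(3) by blast
  have op: "open (f' -` V \<inter> U)"
    using U(3)[of 0] U(1) V(1) by (auto simp: continuous_on_open_vimage)
  have "C_k_on k (f' -` V \<inter> U) (g' \<circ> f')" for k
    using U(3)[of k] V(3)[of k] by (intro C_k_on_compose[OF op V(1)]) (auto intro: C_k_on_subset)
  moreover have "x \<in> f' -` V \<inter> U" using x U V by auto
  moreover have "\<forall>y\<in>S \<inter> (f' -` V \<inter> U). (g' \<circ> f') y = (g \<circ> f) y"
    using U(4) V(4) assms(3) by auto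
  ultimately show "\<exists>U ga. open U \<and> x \<in> U \<and> (\<forall>k. C_k_on k U ga) \<and> (\<forall>y\<in>S \<inter> U. ga y = (g \<circ> f) y)"
    using op by blast
qed

lemma smooth_on_combine:
  fixes f :: "'a::euclidean_space \<Rightarrow> 'b::euclidean_space" and g :: "'a \<Rightarrow> 'c::euclidean_space"
    and h :: "'b \<Rightarrow> 'c \<Rightarrow> 'd::euclidean_space"
  assumes "smooth_on S f" "smooth_on S g"
    and "\<And>U k (f :: 'a \<Rightarrow> 'b) (g :: 'a \<Rightarrow> 'c). open U \<Longrightarrow> C_k_on k U f \<Longrightarrow> C_k_on k U g \<Longrightarrow> C_k_on k U (\<lambda>x. h (f x) (g x))"
  shows "smooth_on S (\<lambda>x. h (f x) (g x))"
proof (rule smooth_onI)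
  fix x assume x: "x \<in> S"
  obtain U f' where U: "open U" "x \<in> U" "\<And>k. C_k_on k U f'" "\<And>y. y \<in> S \<Longrightarrow> y \<in> U \<Longrightarrow> f' y = f y"
    using smooth_onE[OF assms(1) x] by blast
  obtain V g' where V: "open V" "x \<in> V" "\<And>k. C_k_on k V g'" "\<And>y. y \<in> S \<Longrightarrow> y \<in> V \<Longrightarrow> g' y = g y"
    using smooth_onE[OF assms(2) x] by blast
  have "C_k_on k (U \<inter> V) (\<lambda>x. h (f' x) (g' x))" for k
    by (rule assms(3)[OF open_Int[OF U(1) V(1)] C_k_on_subset[OF U(3)] C_k_on_subset[OF V(3)]]) auto
  then show "\<exists>W i. open W \<and> x \<in> W \<and> (\<forall>k. C_k_on k W i) \<and> (\<forall>y\<in>S \<inter> W. i y = h (f y) (g y))"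
    using U V by (intro exI[of _ "U \<inter> V"] exI[of _ "\<lambda>x. h (f' x) (g' x)"]) auto
qed

lemma smooth_on_add:
  fixes f g :: "'a::euclidean_space \<Rightarrow> 'b::euclidean_space"
  shows "smooth_on S f \<Longrightarrow> smooth_on S g \<Longrightarrow> smooth_on S (\<lambda>x. f x + g x)"
  by (rule smooth_on_combine) (auto intro: C_k_on_add)

lemma smooth_on_mult:
  fixes f g :: "'a::euclidean_space \<Rightarrow> real"
  shows "smooth_on S f \<Longrightarrow> smooth_on S g \<Longrightarrow> smooth_on S (\<lambda>x. f x * g x)"
  by (rule smooth_on_combine) (auto intro: bounded_bilinear.C_k_on_prod[OF bounded_bilinear_mult])

section \<open>Bump functions\<close>

lemma tendsto_poly_div_exp_0: "((\<lambda>x. poly p x / exp x) \<longlongrightarrow> (0::real)) at_top"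
proof -
  have "((\<lambda>x. \<Sum>i\<le>degree p. coeff p i * (x ^ i / exp x)) \<longlongrightarrow> (\<Sum>i\<le>degree p. coeff p i * 0)) at_top"
    by (intro tendsto_intros tendsto_power_div_exp_0)
  then show ?thesis by (simp add: poly_altdef sum_divide_distrib)
qed

text \<open>With \<open>u = 1/t\<close>, these are the functions \<open>p(u) e\<^sup>-\<^sup>u\<close> for \<open>t > 0\<close>, extended by zero. The polynomial factor makes
the family closed under differentiation, so that \<open>C\<^sup>k\<close> follows for the whole family by induction on \<open>k\<close>.\<close>

definition flat :: "real poly \<Rightarrow> real \<Rightarrow> real"
  where "flat p t = (if t > 0 then poly p (1 / t) / exp (1 / t) else 0)"

text \<open>Away from zero this is the product rule with \<open>du/dt = - u\<^sup>2\<close>. At zero the right difference quotient is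
\<open>u p(u) e\<^sup>-\<^sup>u\<close> with \<open>u \<rightarrow> \<infinity>\<close>, and the exponential wins.\<close>

lemma flat_derivative:
  "(flat p has_real_derivative flat (monom 1 2 * (p - pderiv p)) t) (at t)"
proof -
  consider "t > 0" | "t < 0" | "t = 0" by linarith
  then show ?thesis
  proof cases
    case 1
    have "((\<lambda>t. poly p (1 / t) / exp (1 / t)) has_real_derivative flat (monom 1 2 * (p - pderiv p)) t) (at t)"
    proof -
      have "((\<lambda>t. poly p (1 / t)) has_real_derivative poly (pderiv p) (1 / t) * (- 1 / t\<^sup>2)) (at t)"
        using 1 by (intro DERIV_chain2[OF poly_DERIV]) (auto intro!: derivative_eq_intros simp: power2_eq_square)
      moreover have "((\<lambda>t. exp (1 / t)) has_real_derivative exp (1 / t) * (- 1 / t\<^sup>2)) (at t)"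
        using 1 by (auto intro!: derivative_eq_intros simp: power2_eq_square)
      ultimately have "((\<lambda>t. poly p (1 / t) / exp (1 / t)) has_real_derivative
          (poly (pderiv p) (1 / t) * (- 1 / t\<^sup>2) * exp (1 / t) -
            poly p (1 / t) * (exp (1 / t) * (- 1 / t\<^sup>2))) / (exp (1 / t) * exp (1 / t))) (at t)"
        by (rule DERIV_divide) simp
      also have "(poly (pderiv p) (1 / t) * (- 1 / t\<^sup>2) * exp (1 / t) -
            poly p (1 / t) * (exp (1 / t) * (- 1 / t\<^sup>2))) / (exp (1 / t) * exp (1 / t)) =
          flat (monom 1 2 * (p - pderiv p)) t"
        using 1 by (simp add: flat_def poly_monom field_simps)
      finally show ?thesis .
    qed
    then show ?thesis
      by (rule has_field_derivative_transform_within_open[where S = "{0<..}"]) (use 1 in \<open>auto simp: flat_def\<close>)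
  next
    case 2
    have "((\<lambda>t. 0) has_real_derivative flat (monom 1 2 * (p - pderiv p)) t) (at t)"
      using 2 by (auto simp: flat_def)
    then show ?thesis
      by (rule has_field_derivative_transform_within_open[where S = "{..<0}"]) (use 2 in \<open>auto simp: flat_def\<close>)
  next
    case 3
    have "((\<lambda>h. flat p h / h) \<longlongrightarrow> 0) (at_right 0)"
    proof -
      have "((\<lambda>h. poly (pCons 0 p) (inverse h) / exp (inverse h)) \<longlongrightarrow> (0::real)) (at_right 0)"
        by (rule filterlim_compose[OF tendsto_poly_div_exp_0 filterlim_inverse_at_top_right])
      moreover have "\<forall>\<^sub>F h in at_right 0. poly (pCons 0 p) (inverse h) / exp (inverse h) = flat p h / h"
        by (auto simp: flat_def eventually_at_filter field_simps)
      ultimately show ?thesis by (rule Lim_transform_eventually)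
    qed
    moreover have "((\<lambda>h. flat p h / h) \<longlongrightarrow> 0) (at_left 0)"
      by (rule Lim_transform_eventually[OF tendsto_const]) (auto simp: flat_def eventually_at_filter)
    ultimately have "((\<lambda>h. flat p h / h) \<longlongrightarrow> 0) (at 0)" by (simp add: filterlim_at_split)
    moreover have "flat p 0 = 0" "flat (monom 1 2 * (p - pderiv p)) 0 = 0" by (simp_all add: flat_def)
    ultimately show ?thesis using 3 by (simp add: DERIV_def)
  qed
qed

lemma C_k_on_flat: "C_k_on k UNIV (flat p)"
proof (induction k arbitrary: p)
  case 0
  show ?case using DERIV_isCont[OF flat_derivative] by (simp add: continuous_on_eq_continuous_at)
next
  case (Suc k)
  show ?case
    by (rule C_k_on_SucI[OF open_UNIV flat_derivative[unfolded has_field_derivative_def]])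
      (intro bounded_bilinear.C_k_on_prod[OF bounded_bilinear_mult] open_UNIV Suc.IH C_k_on_const)
qed

definition bump :: "'a::euclidean_space \<Rightarrow> real \<Rightarrow> 'a \<Rightarrow> real"
  where "bump a e x = flat 1 (e\<^sup>2 - (x - a) \<bullet> (x - a))"

lemma C_k_on_bump: "C_k_on k UNIV (bump a e)"
proof -
  have "C_k_on k UNIV (\<lambda>x. x - a)" using C_k_on_add[OF open_UNIV C_k_on_linear[OF open_UNIV bounded_linear_ident] C_k_on_const[OF open_UNIV], of k "-a"] by simp
  then have "C_k_on k UNIV (\<lambda>x. e\<^sup>2 + (-1) * ((x - a) \<bullet> (x - a)))"
    by (intro C_k_on_add bounded_bilinear.C_k_on_prod[OF bounded_bilinear_mult]
       bounded_bilinear.C_k_on_prod[OF bounded_bilinear_inner]  C_k_on_const open_UNIV)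
  from C_k_on_compose[OF open_UNIV open_UNIV subset_UNIV this C_k_on_flat, of 1]
  show ?thesis by (simp add: o_def bump_def[abs_def])
qed

lemma bump_centre: "e > 0 \<Longrightarrow> bump a e a > 0"
  by (simp add: bump_def flat_def)

lemma bump_outside: "e > 0 \<Longrightarrow> x \<notin> cball a e \<Longrightarrow> bump a e x = 0"
  by (auto simp: bump_def flat_def dist_norm dot_square_norm norm_minus_commute[of a] not_le not_less
      intro!: power_mono)

section \<open>Smooth maps between manifolds\<close>

lemma is_chartD:
  assumes "is_chart E (U, \<phi>)"
  shows "open U" "inj_on \<phi> U" "continuous_on U \<phi>" "continuous_on (\<phi> ` U) (inv_into U \<phi>)"
    "openin (top_of_set E) (\<phi> ` U)"
  using assms unfolding is_chart_def by (auto simp: homeomorphism_def intro: inj_on_inverseI)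

lemma smooth_manifold_chart:
  assumes "smooth_manifold E A"
  obtains U \<phi> where "(U, \<phi>) \<in> A" "x \<in> U"
proof -
  have "x \<in> (\<Union>c\<in>A. fst c)" using assms unfolding smooth_manifold_def by blast
  then show thesis using that by auto
qed

lemma smooth_manifold_is_chart: "smooth_manifold E A \<Longrightarrow> (U, \<phi>) \<in> A \<Longrightarrow> is_chart E (U, \<phi>)"
  unfolding smooth_manifold_def by blast

lemma smooth_manifold_transition:
  assumes "smooth_manifold E A" "(U, \<phi>) \<in> A" "(V, \<psi>) \<in> A"
  shows "smooth_on (\<phi> ` (U \<inter> V)) (\<psi> \<circ> inv_into U \<phi>)"
proof -
  have "compatible_charts (U, \<phi>) (V, \<psi>)" using assms unfolding smooth_manifold_def by blast
  then show ?thesis by (simp add: compatible_charts_def)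
qed

lemma smooth_map_onE:
  assumes "smooth_map_on S A B f" "x \<in> S"
  obtains U \<phi> V \<psi> W where "(U, \<phi>) \<in> A" "(V, \<psi>) \<in> B" "open W" "x \<in> W" "W \<subseteq> S" "W \<subseteq> U" "f ` W \<subseteq> V"
    "smooth_on (\<phi> ` W) (\<psi> \<circ> f \<circ> inv_into U \<phi>)"
  using bspec[OF assms(1)[unfolded smooth_map_on_def] assms(2)] that by auto

lemma smooth_map_onI:
  assumes "\<And>x. x \<in> S \<Longrightarrow> \<exists>U \<phi> V \<psi> W. (U, \<phi>) \<in> A \<and> (V, \<psi>) \<in> B \<and> open W \<and> x \<in> W \<and> W \<subseteq> S \<and> W \<subseteq> U \<and>
    f ` W \<subseteq> V \<and> smooth_on (\<phi> ` W) (\<psi> \<circ> f \<circ> inv_into U \<phi>)"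
  shows "smooth_map_on S A B f"
  unfolding smooth_map_on_def
proof
  fix x assume "x \<in> S"
  from assms[OF this] obtain U \<phi> V \<psi> W where *: "(U, \<phi>) \<in> A" "(V, \<psi>) \<in> B" "open W" "x \<in> W" "W \<subseteq> S" "W \<subseteq> U"
    "f ` W \<subseteq> V" "smooth_on (\<phi> ` W) (\<psi> \<circ> f \<circ> inv_into U \<phi>)" by (elim exE conjE)
  show "\<exists>(U, \<phi>)\<in>A. \<exists>(V, \<psi>)\<in>B. \<exists>W. open W \<and> x \<in> W \<and> W \<subseteq> S \<inter> U \<and> f ` W \<subseteq> V \<and>
      smooth_on (\<phi> ` W) (\<psi> \<circ> f \<circ> inv_into U \<phi>)"
    by (rule bexI[OF _ *(1)], rule case_prodI, rule bexI[OF _ *(2)], rule case_prodI, rule exI[of _ W])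
      (use * in blast)
qed

text \<open>Continuity has to be recovered from the coordinate expression, by conjugating with the two charts.
It makes the preimages that are used to shrink domains open.\<close>

lemma smooth_in_charts_imp_continuous_on:
  assumes "is_chart E (U, \<phi>)" "is_chart F (V, \<psi>)" "W \<subseteq> U" "f ` W \<subseteq> V"
    and "smooth_on (\<phi> ` W) (\<psi> \<circ> f \<circ> inv_into U \<phi>)"
  shows "continuous_on W f"
proof -
  have "continuous_on (\<phi> ` W) (\<psi> \<circ> f \<circ> inv_into U \<phi>)"
    using assms(5) by (rule smooth_on_imp_continuous_on)
  then have "continuous_on W (\<lambda>x. (\<psi> \<circ> f \<circ> inv_into U \<phi>) (\<phi> x))"
    by (rule continuous_on_compose2) (use is_chartD(3)[OF assms(1)] assms(3) in \<open>auto intro: continuous_on_subset\<close>)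
  moreover have "(\<psi> \<circ> f \<circ> inv_into U \<phi>) (\<phi> x) = \<psi> (f x)" if "x \<in> W" for x
    using is_chartD(2)[OF assms(1)] assms(3) that by (simp add: subset_iff)
  ultimately have "continuous_on W (\<lambda>x. \<psi> (f x))" by (simp cong: continuous_on_cong)
  then have "continuous_on W (\<lambda>x. inv_into V \<psi> (\<psi> (f x)))"
    by (rule continuous_on_compose2[OF is_chartD(4)[OF assms(2)]]) (use assms(4) in auto)
  moreover have "inv_into V \<psi> (\<psi> (f x)) = f x" if "x \<in> W" for x
    using is_chartD(2)[OF assms(2)] assms(4) that by (simp add: image_subset_iff)
  ultimately show ?thesis by (simp cong: continuous_on_cong)
qed

text \<open>Smoothness asks only for some pair of charts around each point. Inserting the transition maps of the
two atlases shows that every pair of charts serves.\<close>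

lemma smooth_map_on_charts:
  assumes A: "smooth_manifold E A" and B: "smooth_manifold F B" and f: "smooth_map_on S A B f"
    and U: "(U, \<phi>) \<in> A" "x \<in> U" and V: "(V, \<psi>) \<in> B" "f x \<in> V" and "x \<in> S"
  obtains W where "open W" "x \<in> W" "W \<subseteq> S" "W \<subseteq> U" "f ` W \<subseteq> V" "continuous_on W f"
    "smooth_on (\<phi> ` W) (\<psi> \<circ> f \<circ> inv_into U \<phi>)"
proof -
  from f \<open>x \<in> S\<close> obtain U' \<phi>' V' \<psi>' W' where *: "(U', \<phi>') \<in> A" "(V', \<psi>') \<in> B" "open W'" "x \<in> W'" "W' \<subseteq> S"
    "W' \<subseteq> U'" "f ` W' \<subseteq> V'" and sm: "smooth_on (\<phi>' ` W') (\<psi>' \<circ> f \<circ> inv_into U' \<phi>')" by (rule smooth_map_onE)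
  note ch = smooth_manifold_is_chart[OF A U(1)] smooth_manifold_is_chart[OF A *(1)]
    smooth_manifold_is_chart[OF B V(1)] smooth_manifold_is_chart[OF B *(2)]
  have cont: "continuous_on W' f"
    using ch(2,4) *(6,7) sm by (rule smooth_in_charts_imp_continuous_on)
  define W where "W = (f -` V \<inter> W') \<inter> U"
  have "open W" unfolding W_def
    using cont *(3) is_chartD(1)[OF ch(3)] is_chartD(1)[OF ch(1)]
    by (auto simp: continuous_on_open_vimage)
  have sub: "W \<subseteq> W'" "W \<subseteq> U" "f ` W \<subseteq> V" "x \<in> W" unfolding W_def using * U V by auto
  have s1: "smooth_on (\<phi> ` W) (\<phi>' \<circ> inv_into U \<phi>)"
    by (rule smooth_on_subset[OF smooth_manifold_transition[OF A U(1) *(1)] image_mono])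
      (use sub(1,2) *(6) in blast)
  have s2: "smooth_on (\<phi> ` W) ((\<psi>' \<circ> f \<circ> inv_into U' \<phi>') \<circ> (\<phi>' \<circ> inv_into U \<phi>))"
    by (rule smooth_on_compose[OF s1 sm]) (use sub * is_chartD(2)[OF ch(1)] in \<open>auto simp: subset_iff\<close>)
  have s3: "smooth_on (\<phi> ` W) ((\<psi> \<circ> inv_into V' \<psi>') \<circ> ((\<psi>' \<circ> f \<circ> inv_into U' \<phi>') \<circ> (\<phi>' \<circ> inv_into U \<phi>)))"
    by (rule smooth_on_compose[OF s2 smooth_manifold_transition[OF B *(2) V(1)]])
      (use sub * is_chartD(2)[OF ch(1)] is_chartD(2)[OF ch(2)] in \<open>auto simp: subset_iff image_subset_iff\<close>)
  have "smooth_on (\<phi> ` W) (\<psi> \<circ> f \<circ> inv_into U \<phi>)"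
    by (rule smooth_on_cong[OF s3])
      (use sub * is_chartD(2)[OF ch(1)] is_chartD(2)[OF ch(2)] is_chartD(2)[OF ch(4)]
        in \<open>auto simp: subset_iff image_subset_iff\<close>)
  moreover have "W \<subseteq> S" using sub(1) *(5) by auto
  ultimately show thesis
    using \<open>open W\<close> sub continuous_on_subset[OF cont] by (intro that[of W])
qed

lemma smooth_map_on_compose:
  assumes A: "smooth_manifold E A" and B: "smooth_manifold F B"
    and f: "smooth_map_on S A B f" and g: "smooth_map_on T B C g" and sub: "f ` S \<subseteq> T"
  shows "smooth_map_on S A C (\<lambda>x. g (f x))"
proof (rule smooth_map_onI)
  fix x assume x: "x \<in> S"
  obtain U \<phi> where U: "(U, \<phi>) \<in> A" "x \<in> U" using A by (rule smooth_manifold_chart)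
  have "f x \<in> T" using x sub by auto
  with g obtain V \<psi> Z \<theta> W2 where 2: "(V, \<psi>) \<in> B" "(Z, \<theta>) \<in> C" "open W2" "f x \<in> W2" "W2 \<subseteq> T" "W2 \<subseteq> V" "g ` W2 \<subseteq> Z"
    "smooth_on (\<psi> ` W2) (\<theta> \<circ> g \<circ> inv_into V \<psi>)" by (rule smooth_map_onE)
  obtain W1 where 1: "open W1" "x \<in> W1" "W1 \<subseteq> S" "W1 \<subseteq> U" "f ` W1 \<subseteq> V" "continuous_on W1 f"
    "smooth_on (\<phi> ` W1) (\<psi> \<circ> f \<circ> inv_into U \<phi>)"
    using smooth_map_on_charts[OF A B f U 2(1) subsetD[OF 2(6,4)] x] .
  define W where "W = f -` W2 \<inter> W1"
  have W: "open W" unfolding W_def using 1 2 by (auto simp: continuous_on_open_vimage)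
  have WW: "W \<subseteq> W1" "f ` W \<subseteq> W2" "x \<in> W" using 1 2 by (auto simp: W_def)
  note inj = is_chartD(2)[OF smooth_manifold_is_chart[OF A U(1)]] is_chartD(2)[OF smooth_manifold_is_chart[OF B 2(1)]]
  have "smooth_on (\<phi> ` W) ((\<theta> \<circ> g \<circ> inv_into V \<psi>) \<circ> (\<psi> \<circ> f \<circ> inv_into U \<phi>))"
    by (rule smooth_on_compose[OF smooth_on_subset[OF 1(7)] 2(8)])
      (use WW inj 1 in \<open>auto simp: subset_iff\<close>)
  then have "smooth_on (\<phi> ` W) (\<theta> \<circ> (\<lambda>x. g (f x)) \<circ> inv_into U \<phi>)"
    by (rule smooth_on_cong) (use WW inj 1 in \<open>auto simp: subset_iff image_subset_iff\<close>)
  moreover have "W \<subseteq> S" "W \<subseteq> U" "(\<lambda>x. g (f x)) ` W \<subseteq> Z"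
    using WW(1,2) 1(3,4) 2(7) by (auto simp: image_subset_iff subset_iff)
  ultimately show "\<exists>U \<phi> V \<psi> W. (U, \<phi>) \<in> A \<and> (V, \<psi>) \<in> C \<and> open W \<and> x \<in> W \<and> W \<subseteq> S \<and> W \<subseteq> U \<and>
    (\<lambda>x. g (f x)) ` W \<subseteq> V \<and> smooth_on (\<phi> ` W) (\<psi> \<circ> (\<lambda>x. g (f x)) \<circ> inv_into U \<phi>)"
    using U(1) 2(2) W WW(3) by blast
qed

lemma smooth_map_on_subset:
  assumes "smooth_manifold E A" "smooth_map_on S A B f" "open T" "T \<subseteq> S"
  shows "smooth_map_on T A B f"
proof (rule smooth_map_onI)
  fix x assume "x \<in> T"
  then have "x \<in> S" using assms by auto
  with assms(2) obtain U \<phi> V \<psi> W where "(U, \<phi>) \<in> A" "(V, \<psi>) \<in> B" "open W" "x \<in> W" "W \<subseteq> S" "W \<subseteq> U"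
    "f ` W \<subseteq> V" "smooth_on (\<phi> ` W) (\<psi> \<circ> f \<circ> inv_into U \<phi>)" by (rule smooth_map_onE)
  then show "\<exists>U \<phi> V \<psi> W. (U, \<phi>) \<in> A \<and> (V, \<psi>) \<in> B \<and> open W \<and> x \<in> W \<and> W \<subseteq> T \<and> W \<subseteq> U \<and>
    f ` W \<subseteq> V \<and> smooth_on (\<phi> ` W) (\<psi> \<circ> f \<circ> inv_into U \<phi>)"
    using assms(3) \<open>x \<in> T\<close>
    by (intro exI[of _ U] exI[of _ \<phi>] exI[of _ V] exI[of _ \<psi>] exI[of _ "W \<inter> T"])
      (auto intro: smooth_on_subset)
qed

text \<open>Used to glue a function that is given on two overlapping open sets, such as one cut off by a bump function.\<close>

lemma smooth_map_on_local:
  assumes A: "smooth_manifold E A"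
    and loc: "\<And>x. x \<in> S \<Longrightarrow> \<exists>T g. x \<in> T \<and> T \<subseteq> S \<and> smooth_map_on T A B g \<and> (\<forall>y\<in>T. g y = f y)"
  shows "smooth_map_on S A B f"
proof (rule smooth_map_onI)
  fix x assume x: "x \<in> S"
  from loc[OF x] obtain T g where T: "x \<in> T" "T \<subseteq> S" and g: "smooth_map_on T A B g"
    and eq: "\<And>y. y \<in> T \<Longrightarrow> g y = f y" by blast
  from g T(1) obtain U \<phi> V \<psi> W where *: "(U, \<phi>) \<in> A" "(V, \<psi>) \<in> B" "open W" "x \<in> W" "W \<subseteq> T" "W \<subseteq> U"
    "g ` W \<subseteq> V" and sm: "smooth_on (\<phi> ` W) (\<psi> \<circ> g \<circ> inv_into U \<phi>)" by (rule smooth_map_onE)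
  have "smooth_on (\<phi> ` W) (\<psi> \<circ> f \<circ> inv_into U \<phi>)"
    by (rule smooth_on_cong[OF sm])
      (use * eq is_chartD(2)[OF smooth_manifold_is_chart[OF A *(1)]] in \<open>auto simp: subset_iff\<close>)
  then show "\<exists>U \<phi> V \<psi> W. (U, \<phi>) \<in> A \<and> (V, \<psi>) \<in> B \<and> open W \<and> x \<in> W \<and> W \<subseteq> S \<and> W \<subseteq> U \<and>
    f ` W \<subseteq> V \<and> smooth_on (\<phi> ` W) (\<psi> \<circ> f \<circ> inv_into U \<phi>)"
    using * eq T by (intro exI[of _ U] exI[of _ \<phi>] exI[of _ V] exI[of _ \<psi>] exI[of _ W]) (auto simp: image_subset_iff subset_iff)
qed

lemma smooth_manifold_real: "smooth_manifold UNIV real_atlas"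
proof -
  have "inv_into UNIV (id :: real \<Rightarrow> real) = id" by (auto simp: inv_f_eq)
  moreover have "smooth_on S (id :: real \<Rightarrow> real)" for S
    by (rule C_k_on_imp_smooth_on) (auto intro: C_k_on_linear simp: id_def bounded_linear_ident)
  ultimately show ?thesis
    unfolding smooth_manifold_def real_atlas_def is_chart_def compatible_charts_def homeomorphism_def
    by (simp add: id_def o_def)
qed

lemma smooth_map_on_realI:
  assumes "\<And>x. x \<in> S \<Longrightarrow> \<exists>U \<phi> W. (U, \<phi>) \<in> A \<and> open W \<and> x \<in> W \<and> W \<subseteq> S \<and> W \<subseteq> U \<and>
    smooth_on (\<phi> ` W) (\<lambda>z. f (inv_into U \<phi> z))"
  shows "smooth_map_on S A real_atlas f"
proof (rule smooth_map_onI)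
  fix x assume "x \<in> S"
  from assms[OF this] obtain U \<phi> W where *: "(U, \<phi>) \<in> A" "open W" "x \<in> W" "W \<subseteq> S" "W \<subseteq> U"
    "smooth_on (\<phi> ` W) (\<lambda>z. f (inv_into U \<phi> z))" by (elim exE conjE)
  then show "\<exists>U \<phi> V \<psi> W. (U, \<phi>) \<in> A \<and> (V, \<psi>) \<in> real_atlas \<and> open W \<and> x \<in> W \<and> W \<subseteq> S \<and> W \<subseteq> U \<and>
    f ` W \<subseteq> V \<and> smooth_on (\<phi> ` W) (\<psi> \<circ> f \<circ> inv_into U \<phi>)"
    by (intro exI[of _ U] exI[of _ \<phi>] exI[of _ UNIV] exI[of _ id] exI[of _ W])
      (auto simp: real_atlas_def o_def)
qed

lemma smooth_map_on_realE:
  assumes "smooth_manifold E A" "smooth_map_on S A real_atlas f" "x \<in> S" "(U, \<phi>) \<in> A" "x \<in> U"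
  obtains W where "open W" "x \<in> W" "W \<subseteq> S" "W \<subseteq> U" "smooth_on (\<phi> ` W) (\<lambda>z. f (inv_into U \<phi> z))"
  by (rule smooth_map_on_charts[OF assms(1) smooth_manifold_real assms(2,4,5), of UNIV id])
    (use assms(3) that in \<open>auto simp: real_atlas_def o_def\<close>)

lemma smooth_map_on_real_combine:
  fixes A :: "('m::{t2_space,second_countable_topology}, 'e::euclidean_space) chart set"
  assumes A: "smooth_manifold E A"
    and f: "smooth_map_on S A real_atlas f" and g: "smooth_map_on S A real_atlas g"
    and h: "\<And>(T :: 'e set) f g. smooth_on T f \<Longrightarrow> smooth_on T g \<Longrightarrow> smooth_on T (\<lambda>x. h (f x) (g x))"
  shows "smooth_map_on S A real_atlas (\<lambda>x. h (f x) (g x))"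
proof (rule smooth_map_on_realI)
  fix x assume x: "x \<in> S"
  obtain U \<phi> where U: "(U, \<phi>) \<in> A" "x \<in> U" using A by (rule smooth_manifold_chart)
  obtain V where V: "open V" "x \<in> V" "V \<subseteq> S" "V \<subseteq> U" "smooth_on (\<phi> ` V) (\<lambda>z. f (inv_into U \<phi> z))"
    using A f x U by (rule smooth_map_on_realE)
  obtain W where W: "open W" "x \<in> W" "W \<subseteq> S" "W \<subseteq> U" "smooth_on (\<phi> ` W) (\<lambda>z. g (inv_into U \<phi> z))"
    using A g x U by (rule smooth_map_on_realE)
  have "smooth_on (\<phi> ` (V \<inter> W)) (\<lambda>z. h (f (inv_into U \<phi> z)) (g (inv_into U \<phi> z)))"
    by (rule h[OF smooth_on_subset[OF V(5)] smooth_on_subset[OF W(5)]]) auto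
  then show "\<exists>U \<phi> W. (U, \<phi>) \<in> A \<and> open W \<and> x \<in> W \<and> W \<subseteq> S \<and> W \<subseteq> U \<and>
    smooth_on (\<phi> ` W) (\<lambda>z. h (f (inv_into U \<phi> z)) (g (inv_into U \<phi> z)))"
    using U V W by (intro exI[of _ U] exI[of _ \<phi>] exI[of _ "V \<inter> W"]) auto
qed

lemma smooth_map_on_add:
  "smooth_manifold E A \<Longrightarrow> smooth_map_on S A real_atlas f \<Longrightarrow> smooth_map_on S A real_atlas g \<Longrightarrow>
    smooth_map_on S A real_atlas (\<lambda>x. f x + g x)"
  by (rule smooth_map_on_real_combine) (auto intro: smooth_on_add)

lemma smooth_map_on_mult:
  "smooth_manifold E A \<Longrightarrow> smooth_map_on S A real_atlas f \<Longrightarrow> smooth_map_on S A real_atlas g \<Longrightarrow>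
    smooth_map_on S A real_atlas (\<lambda>x. f x * g x)"
  by (rule smooth_map_on_real_combine) (auto intro: smooth_on_mult)

lemma smooth_map_on_const:
  assumes A: "smooth_manifold E A" and "open S"
  shows "smooth_map_on S A real_atlas (\<lambda>x. c)"
proof (rule smooth_map_on_realI)
  fix x assume x: "x \<in> S"
  obtain U \<phi> where U: "(U, \<phi>) \<in> A" "x \<in> U" using A by (rule smooth_manifold_chart)
  then show "\<exists>U \<phi> W. (U, \<phi>) \<in> A \<and> open W \<and> x \<in> W \<and> W \<subseteq> S \<and> W \<subseteq> U \<and> smooth_on (\<phi> ` W) (\<lambda>z. c)"
    using is_chartD(1)[OF smooth_manifold_is_chart[OF A U(1)]] x assms(2)
    by (intro exI[of _ U] exI[of _ \<phi>] exI[of _ "S \<inter> U"])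
      (auto intro!: C_k_on_imp_smooth_on C_k_on_const)
qed

lemma smooth_map_on_sum:
  assumes A: "smooth_manifold E A" and "open S" and "\<And>i. i \<in> I \<Longrightarrow> smooth_map_on S A real_atlas (f i)"
  shows "smooth_map_on S A real_atlas (\<lambda>x. \<Sum>i\<in>I. f i x)"
  using assms(3)
  by (induction I rule: infinite_finite_induct)
    (auto intro: smooth_map_on_const[OF assms(1,2)] smooth_map_on_add[OF assms(1)])

text \<open>In product charts a partial map is the coordinate expression of the full map precomposed with the
affine map \<open>e \<mapsto> (e, \<psi>(y))\<close>.\<close>

lemma smooth_map_Pair_left:
  assumes A: "smooth_manifold E A" and B: "smooth_manifold F B" and f: "smooth_map (prod_atlas A B) C f"
  shows "smooth_map A C (\<lambda>x. f (x, y))"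
proof (rule smooth_map_onI)
  fix x
  from f UNIV_I obtain U' \<phi>' Z \<theta> W where *: "(U', \<phi>') \<in> prod_atlas A B" "(Z, \<theta>) \<in> C" "open W" "(x, y) \<in> W" "W \<subseteq> U'"
    "f ` W \<subseteq> Z" and sm: "smooth_on (\<phi>' ` W) (\<theta> \<circ> f \<circ> inv_into U' \<phi>')" by (rule smooth_map_onE)
  from *(1) obtain U \<phi> V \<psi> where eq: "U' = U \<times> V" "\<phi>' = map_prod \<phi> \<psi>" and ch: "(U, \<phi>) \<in> A" "(V, \<psi>) \<in> B"
    unfolding prod_atlas_def by auto
  have inj: "inj_on \<phi> U" "inj_on \<phi>' U'" unfolding eq
    using is_chartD(2)[OF smooth_manifold_is_chart[OF A ch(1)]] is_chartD(2)[OF smooth_manifold_is_chart[OF B ch(2)]]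
    by (auto intro: map_prod_inj_on)
  define W1 where "W1 = (\<lambda>x. (x, y)) -` W"
  have W1: "open W1" "x \<in> W1" "W1 \<subseteq> U" unfolding W1_def
    using * eq by (auto intro!: open_vimage continuous_intros)
  have "smooth_on (\<phi> ` W1) (\<lambda>e. (e, \<psi> y))"
    by (intro C_k_on_imp_smooth_on C_k_on_Pair C_k_on_linear C_k_on_const bounded_linear_ident open_UNIV)
  then have "smooth_on (\<phi> ` W1) ((\<theta> \<circ> f \<circ> inv_into U' \<phi>') \<circ> (\<lambda>e. (e, \<psi> y)))"
    by (rule smooth_on_compose[OF _ sm]) (auto simp: W1_def eq map_prod_def image_iff)
  moreover have "inv_into U' \<phi>' (\<phi> z, \<psi> y) = (z, y)" if "z \<in> W1" for z
    using inv_into_f_f[OF inj(2), of "(z, y)"] that *(5) by (auto simp: W1_def eq)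
  ultimately have "smooth_on (\<phi> ` W1) (\<theta> \<circ> (\<lambda>x. f (x, y)) \<circ> inv_into U \<phi>)"
    by (elim smooth_on_cong) (use inj W1 in \<open>auto simp: subset_iff\<close>)
  then show "\<exists>U \<phi> V \<psi> W. (U, \<phi>) \<in> A \<and> (V, \<psi>) \<in> C \<and> open W \<and> x \<in> W \<and> W \<subseteq> UNIV \<and> W \<subseteq> U \<and>
    (\<lambda>x. f (x, y)) ` W \<subseteq> V \<and> smooth_on (\<phi> ` W) (\<psi> \<circ> (\<lambda>x. f (x, y)) \<circ> inv_into U \<phi>)"
    using ch * W1 by (intro exI[of _ U] exI[of _ \<phi>] exI[of _ Z] exI[of _ \<theta>] exI[of _ W1]) (auto simp: W1_def)
qed

lemma smooth_map_Pair_right: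
  assumes A: "smooth_manifold E A" and B: "smooth_manifold F B" and f: "smooth_map (prod_atlas A B) C f"
  shows "smooth_map B C (\<lambda>y. f (x, y))"
proof (rule smooth_map_onI)
  fix y
  from f UNIV_I obtain U' \<phi>' Z \<theta> W where *: "(U', \<phi>') \<in> prod_atlas A B" "(Z, \<theta>) \<in> C" "open W" "(x, y) \<in> W" "W \<subseteq> U'"
    "f ` W \<subseteq> Z" and sm: "smooth_on (\<phi>' ` W) (\<theta> \<circ> f \<circ> inv_into U' \<phi>')" by (rule smooth_map_onE)
  from *(1) obtain U \<phi> V \<psi> where eq: "U' = U \<times> V" "\<phi>' = map_prod \<phi> \<psi>" and ch: "(U, \<phi>) \<in> A" "(V, \<psi>) \<in> B"
    unfolding prod_atlas_def by auto
  have inj: "inj_on \<psi> V" "inj_on \<phi>' U'" unfolding eq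
    using is_chartD(2)[OF smooth_manifold_is_chart[OF A ch(1)]] is_chartD(2)[OF smooth_manifold_is_chart[OF B ch(2)]]
    by (auto intro: map_prod_inj_on)
  define W1 where "W1 = (\<lambda>y. (x, y)) -` W"
  have W1: "open W1" "y \<in> W1" "W1 \<subseteq> V" unfolding W1_def
    using * eq by (auto intro!: open_vimage continuous_intros)
  have "smooth_on (\<psi> ` W1) (\<lambda>e. (\<phi> x, e))"
    by (intro C_k_on_imp_smooth_on C_k_on_Pair C_k_on_linear C_k_on_const bounded_linear_ident open_UNIV)
  then have "smooth_on (\<psi> ` W1) ((\<theta> \<circ> f \<circ> inv_into U' \<phi>') \<circ> (\<lambda>e. (\<phi> x, e)))"
    by (rule smooth_on_compose[OF _ sm]) (auto simp: W1_def eq map_prod_def image_iff)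
  moreover have "inv_into U' \<phi>' (\<phi> x, \<psi> z) = (x, z)" if "z \<in> W1" for z
    using inv_into_f_f[OF inj(2), of "(x, z)"] that *(5) by (auto simp: W1_def eq)
  ultimately have "smooth_on (\<psi> ` W1) (\<theta> \<circ> (\<lambda>y. f (x, y)) \<circ> inv_into V \<psi>)"
    by (elim smooth_on_cong) (use inj W1 in \<open>auto simp: subset_iff\<close>)
  then show "\<exists>U \<phi> V \<psi> W. (U, \<phi>) \<in> B \<and> (V, \<psi>) \<in> C \<and> open W \<and> y \<in> W \<and> W \<subseteq> UNIV \<and> W \<subseteq> U \<and>
    (\<lambda>y. f (x, y)) ` W \<subseteq> V \<and> smooth_on (\<phi> ` W) (\<psi> \<circ> (\<lambda>y. f (x, y)) \<circ> inv_into U \<phi>)"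
    using ch * W1 by (intro exI[of _ V] exI[of _ \<psi>] exI[of _ Z] exI[of _ \<theta>] exI[of _ W1]) (auto simp: W1_def)
qed

text \<open>A Euclidean bump is transported by a chart and extended by zero. Its support is the image of a
compact set, hence compact, and therefore closed because the manifold is Hausdorff: this is what
makes the extension smooth at the points outside the chart.\<close>

lemma smooth_bump_function:
  assumes A: "smooth_manifold E A" and S: "open S" "p \<in> S"
  obtains \<beta> K where "smooth_fun A \<beta>" "\<beta> p \<noteq> 0" "closed K" "K \<subseteq> S" "\<And>x. x \<notin> K \<Longrightarrow> \<beta> x = 0"
proof -
  obtain U \<phi> where U: "(U, \<phi>) \<in> A" "p \<in> U" using A by (rule smooth_manifold_chart)
  note ch = is_chartD[OF smooth_manifold_is_chart[OF A U(1)]]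
  have "openin (top_of_set E) (\<phi> ` (S \<inter> U))"
  proof -
    have "openin (top_of_set (\<phi> ` U)) (\<phi> ` U \<inter> inv_into U \<phi> -` (S \<inter> U))"
      using continuous_openin_preimage_gen[OF ch(4)] S ch(1) by blast
    also have "\<phi> ` U \<inter> inv_into U \<phi> -` (S \<inter> U) = \<phi> ` (S \<inter> U)"
      using ch(2) by auto
    finally show ?thesis using ch(5) by (rule openin_trans)
  qed
  then obtain O' where O': "open O'" "\<phi> ` (S \<inter> U) = E \<inter> O'" by (auto simp: openin_open)
  then have "\<phi> p \<in> O'" using S U by auto
  then obtain e where e: "e > 0" "cball (\<phi> p) e \<subseteq> O'" using O' open_contains_cball by blast
  \<comment> \<open>the intersection with the model space matters: charts take values in a linear subspace\<close>
  define K where "K = inv_into U \<phi> ` (E \<inter> cball (\<phi> p) e)"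
  define \<beta> where "\<beta> x = (if x \<in> U then bump (\<phi> p) e (\<phi> x) else 0)" for x
  have EK: "E \<inter> cball (\<phi> p) e \<subseteq> \<phi> ` (S \<inter> U)" using e O' by auto
  have "closed E" using A by (auto simp: smooth_manifold_def closed_subspace)
  have "compact K" unfolding K_def
    by (rule compact_continuous_image[OF continuous_on_subset[OF ch(4)]])
      (use EK \<open>closed E\<close> in \<open>auto intro!: closed_Int_compact\<close>)
  then have K: "closed K" by (rule compact_imp_closed)
  have KS: "K \<subseteq> S \<inter> U"
  proof
    fix x assume "x \<in> K"
    then obtain z where z: "z \<in> E \<inter> cball (\<phi> p) e" "x = inv_into U \<phi> z" unfolding K_def by blast
    then obtain y where "y \<in> S \<inter> U" "z = \<phi> y" using EK by blast
    then show "x \<in> S \<inter> U" using z ch(2) by simp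
  qed
  have out: "\<beta> x = 0" if "x \<notin> K" for x
  proof (cases "x \<in> U")
    case True
    have "\<phi> x \<in> E" using True openin_imp_subset[OF ch(5)] by auto
    moreover have "\<phi> x \<notin> E \<inter> cball (\<phi> p) e"
      using that True ch(2) unfolding K_def by (metis image_eqI inv_into_f_f)
    ultimately show ?thesis using True bump_outside[OF e(1)] by (simp add: \<beta>_def)
  qed (simp add: \<beta>_def)
  have "smooth_fun A \<beta>"
  proof (rule smooth_map_on_local[OF A])
    fix x
    show "\<exists>T g. x \<in> T \<and> T \<subseteq> UNIV \<and> smooth_map_on T A real_atlas g \<and> (\<forall>y\<in>T. g y = \<beta> y)"
    proof (cases "x \<in> U")
      case True
      have "smooth_on (\<phi> ` U) (bump (\<phi> p) e)" by (intro C_k_on_imp_smooth_on C_k_on_bump)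
      then have "smooth_on (\<phi> ` U) (\<lambda>z. \<beta> (inv_into U \<phi> z))"
        by (rule smooth_on_cong) (use ch(2) in \<open>auto simp: \<beta>_def\<close>)
      then have "smooth_map_on U A real_atlas \<beta>"
        using U(1) ch(1) by (intro smooth_map_on_realI exI[of _ U] exI[of _ \<phi>]) auto
      then show ?thesis using True by blast
    next
      case False
      then have "x \<in> - K" using KS by auto
      moreover have "smooth_map_on (- K) A real_atlas (\<lambda>_. 0)"
        using A K by (intro smooth_map_on_const) auto
      ultimately show ?thesis using out by (intro exI[of _ "- K"] exI[of _ "\<lambda>_. 0"]) auto
    qed
  qed
  moreover have "\<beta> p \<noteq> 0" using U bump_centre[OF e(1), of "\<phi> p"] by (simp add: \<beta>_def)
  ultimately show thesis using K KS out that by blast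
qed

section \<open>Tangent vectors\<close>

lemma tangent_spaceD:
  assumes "v \<in> tangent_space A p"
  shows "smooth_fun A f \<Longrightarrow> smooth_fun A g \<Longrightarrow> v (\<lambda>x. f x + g x) = v f + v g"
    and "smooth_fun A f \<Longrightarrow> v (\<lambda>x. c * f x) = c * v f"
    and "smooth_fun A f \<Longrightarrow> smooth_fun A g \<Longrightarrow> v (\<lambda>x. f x * g x) = f p * v g + g p * v f"
    and "\<not> smooth_fun A f \<Longrightarrow> v f = 0"
  using assms unfolding tangent_space_def by blast+

lemma subspace_tangent_space: "subspace (tangent_space A p)"
  unfolding subspace_def
  by (auto simp: tangent_space_def scaleR_fun_def algebra_simps)

text \<open>The Leibniz rule at \<open>1 = 1 \<cdot> 1\<close> gives \<open>v(1) = 2 v(1)\<close>.\<close>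

lemma tangent_const:
  assumes A: "smooth_manifold E A" and v: "v \<in> tangent_space A p"
  shows "v (\<lambda>x. c) = 0"
proof -
  have 1: "smooth_fun A (\<lambda>x. 1)" using A by (rule smooth_map_on_const) simp
  from tangent_spaceD(3)[OF v 1 1] have "v (\<lambda>x. 1) = 0" by simp
  with tangent_spaceD(2)[OF v 1, of c] show ?thesis by simp
qed

lemma tangent_map_in_tangent_space:
  assumes A: "smooth_manifold E A" and B: "smooth_manifold F B" and h: "smooth_map A B h"
    and v: "v \<in> tangent_space A p"
  shows "tangent_map A B h v \<in> tangent_space B (h p)"
proof -
  have "smooth_fun A (\<lambda>x. f (h x))" if "smooth_fun B f" for f
    using A B h that by (rule smooth_map_on_compose) simp
  then show ?thesis
    using smooth_map_on_add[OF B, of UNIV] smooth_map_on_mult[OF B, of UNIV]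
      smooth_map_on_mult[OF B smooth_map_on_const[OF B], of UNIV]
    by (auto simp: tangent_space_def[of B] tangent_map_def o_def tangent_spaceD[OF v])
qed

section \<open>Internal direct sums\<close>

lemma direct_sum2D:
  assumes "direct_sum X [V, W]"
  shows "subspace V" "subspace W" "X = {a + b |a b. a \<in> V \<and> b \<in> W}"
  using assms by (auto simp: direct_sum_def bij_betw_def set_Cons_def image_iff) (fastforce, force)

lemma direct_sum4D:
  assumes "direct_sum X [V1, V2, V3, V4]"
  shows "\<And>a b c d. a \<in> V1 \<Longrightarrow> b \<in> V2 \<Longrightarrow> c \<in> V3 \<Longrightarrow> d \<in> V4 \<Longrightarrow> a + (b + (c + d)) \<in> X"
    and "\<And>a b c d a' b' c' d'. a \<in> V1 \<Longrightarrow> b \<in> V2 \<Longrightarrow> c \<in> V3 \<Longrightarrow> d \<in> V4 \<Longrightarrow>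
      a' \<in> V1 \<Longrightarrow> b' \<in> V2 \<Longrightarrow> c' \<in> V3 \<Longrightarrow> d' \<in> V4 \<Longrightarrow>
      a + (b + (c + d)) = a' + (b' + (c' + d')) \<Longrightarrow> a = a' \<and> b = b' \<and> c = c' \<and> d = d'"
    and "subspace V1" "subspace V2" "subspace V3" "subspace V4"
proof -
  have bij: "bij_betw sum_list (listset [V1, V2, V3, V4]) X"
    and sub: "subspace V1" "subspace V2" "subspace V3" "subspace V4"
    using assms by (auto simp: direct_sum_def)
  have mem: "[a, b, c, d] \<in> listset [V1, V2, V3, V4] \<longleftrightarrow> a \<in> V1 \<and> b \<in> V2 \<and> c \<in> V3 \<and> d \<in> V4" for a b c d
    by (simp add: set_Cons_def)
  show "a + (b + (c + d)) \<in> X" if "a \<in> V1" "b \<in> V2" "c \<in> V3" "d \<in> V4" for a b c d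
    using bij_betw_apply[OF bij, of "[a, b, c, d]"] mem that by simp
  show "a = a' \<and> b = b' \<and> c = c' \<and> d = d'"
    if "a \<in> V1" "b \<in> V2" "c \<in> V3" "d \<in> V4" "a' \<in> V1" "b' \<in> V2" "c' \<in> V3" "d' \<in> V4"
      "a + (b + (c + d)) = a' + (b' + (c' + d'))" for a b c d a' b' c' d'
    using inj_onD[OF bij_betw_imp_inj_on[OF bij], of "[a, b, c, d]" "[a', b', c', d']"] mem that by simp
  show "subspace V1" "subspace V2" "subspace V3" "subspace V4" by fact+
qed

section \<open>Sections of subbundles\<close>

lemma sum_fun_apply: "(\<Sum>i\<in>I. F i) x = (\<Sum>i\<in>I. F i x)"
  by (induction I rule: infinite_finite_induct) auto

text \<open>The vector is written in a local frame with constant coefficients; multiplying by a bump function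
and dividing by its value at the point globalizes this local section.\<close>

lemma smooth_section_through:
  assumes A: "smooth_manifold E A" and D: "subbundle A D" and d: "d \<in> D p"
  obtains X where "smooth_vector_field_on UNIV A X" "\<And>x. X x \<in> D x" "X p = d"
proof -
  from D obtain S and k :: nat and Y where S: "open S" "p \<in> S"
    and Y: "\<And>i. i < k \<Longrightarrow> smooth_vector_field_on S A (Y i)"
    and inj: "\<And>x. x \<in> S \<Longrightarrow> inj_on (\<lambda>i. Y i x) {..<k}"
    and span: "\<And>x. x \<in> S \<Longrightarrow> span ((\<lambda>i. Y i x) ` {..<k}) = D x"
    unfolding subbundle_def by metis
  have sub: "subspace (D x)" for x
  proof -
    obtain S' and m :: nat and Z where "x \<in> S'" "\<forall>x\<in>S'. span ((\<lambda>i. Z i x) ` {..<m}) = D x"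
      using D unfolding subbundle_def by metis
    then have "D x = span ((\<lambda>i. Z i x) ` {..<m})" by auto
    then show ?thesis by simp
  qed
  have "d \<in> span ((\<lambda>i. Y i p) ` {..<k})" using d span S by blast
  then obtain u where "d = (\<Sum>w\<in>(\<lambda>i. Y i p) ` {..<k}. u w *\<^sub>R w)"
    by (subst (asm) span_finite) auto
  then have du: "d = (\<Sum>i<k. u (Y i p) *\<^sub>R Y i p)"
    by (simp add: sum.reindex[OF inj[OF S(2)]])
  obtain \<beta> K where \<beta>: "smooth_fun A \<beta>" "\<beta> p \<noteq> 0" and K: "closed K" "K \<subseteq> S"
    and out: "\<And>x. x \<notin> K \<Longrightarrow> \<beta> x = 0"
    using smooth_bump_function[OF A S] by blast
  define c where "c i = u (Y i p) / \<beta> p" for i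
  define X where "X x = (if x \<in> S then (\<Sum>i<k. (c i * \<beta> x) *\<^sub>R Y i x) else 0)" for x
  have XD: "X x \<in> D x" for x
  proof (cases "x \<in> S")
    case True
    have "Y i x \<in> D x" if "i < k" for i
      using span_base[of "Y i x" "(\<lambda>i. Y i x) ` {..<k}"] that span[OF True] by auto
    then show ?thesis using True by (auto simp: X_def intro!: subspace_sum subspace_scale sub)
  qed (simp add: X_def subspace_0[OF sub])
  have XT: "X x \<in> tangent_space A x" for x
  proof (cases "x \<in> S")
    case True
    then show ?thesis using Y
      by (auto simp: X_def smooth_vector_field_on_def intro!: subspace_sum subspace_scale subspace_tangent_space)
  qed (simp add: X_def subspace_0[OF subspace_tangent_space])
  have "smooth_fun A (\<lambda>x. X x f)" if f: "smooth_fun A f" for f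
  proof (rule smooth_map_on_local[OF A])
    fix x
    show "\<exists>T g. x \<in> T \<and> T \<subseteq> UNIV \<and> smooth_map_on T A real_atlas g \<and> (\<forall>y\<in>T. g y = X y f)"
    proof (cases "x \<in> S")
      case True
      have "smooth_map_on S A real_atlas (\<lambda>x. \<Sum>i<k. (c i * \<beta> x) * Y i x f)"
        using Y f A S \<beta>(1)
        by (intro smooth_map_on_sum smooth_map_on_mult smooth_map_on_const)
          (auto simp: smooth_vector_field_on_def intro: smooth_map_on_subset)
      then show ?thesis using True
        by (intro exI[of _ S] exI[of _ "\<lambda>x. \<Sum>i<k. (c i * \<beta> x) * Y i x f"])
          (auto simp: X_def sum_fun_apply scaleR_fun_def)
    next
      case False
      then have "x \<in> - K" using K by auto
      moreover have "smooth_map_on (- K) A real_atlas (\<lambda>_. 0)"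
        using A K by (intro smooth_map_on_const) auto
      ultimately show ?thesis using out
        by (intro exI[of _ "- K"] exI[of _ "\<lambda>_. 0"]) (auto simp: X_def sum_fun_apply scaleR_fun_def)
    qed
  qed
  then have "smooth_vector_field_on UNIV A X" using XT by (auto simp: smooth_vector_field_on_def)
  moreover have "X p = d" using S \<beta>(2) by (simp add: X_def du c_def)
  ultimately show thesis using XD that by blast
qed

section \<open>Fundamental vector fields\<close>

locale lie_group_action =
  fixes E :: "'e::euclidean_space set"
    and A :: "('q::{t2_space,second_countable_topology}, 'e) chart set"
    and EG :: "'h::euclidean_space set"
    and AG :: "('g::{t2_space,second_countable_topology}, 'h) chart set"
    and G :: "'g monoid" (structure)
    and ex :: "'g tangent \<Rightarrow> 'g"
    and l :: "'g \<Rightarrow> 'q \<Rightarrow> 'q"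
  assumes manifold: "smooth_manifold E A"
    and lie_group: "lie_group EG AG G"
    and exponential: "exponential_map AG G ex"
    and action: "free_proper_action A AG G l"
begin

sublocale group G using lie_group by (simp add: lie_group_def)

lemma carrier_UNIV [simp]: "carrier G = UNIV"
  using lie_group by (simp add: lie_group_def)

lemma group_manifold: "smooth_manifold EG AG"
  using lie_group by (simp add: lie_group_def)

lemma group_action: "group_action G UNIV l"
  using action by (simp add: free_proper_action_def)

lemma act_mult: "l (g \<otimes> h) x = l g (l h x)"
  using group_action.composition_rule[OF group_action] by simp

lemma act_one [simp]: "l \<one> x = x"
  using fun_cong[OF group_action.id_eq_one[OF group_action], of x] by simp

lemma act_inv [simp]: "l (inv g) (l g x) = x" "l g (l (inv g) x) = x"
  by (simp_all flip: act_mult)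

lemma act_free: "l g x = l h x \<Longrightarrow> g = h"
proof -
  assume "l g x = l h x"
  then have "l (inv h \<otimes> g) x = x" by (simp add: act_mult)
  then have "inv h \<otimes> g = \<one>" using action by (auto simp: free_proper_action_def)
  then have "h \<otimes> (inv h \<otimes> g) = h" by simp
  then show "g = h" by (simp flip: m_assoc)
qed

lemma orbit_act [simp]: "orbit G l (l g x) = orbit G l x"
proof -
  have "l h x = l (h \<otimes> inv g) (l g x)" for h by (simp add: act_mult)
  then show ?thesis by (auto simp: orbit_def simp flip: act_mult)
qed

lemma smooth_act_point: "smooth_map AG A (\<lambda>g. l g x)"
  using smooth_map_Pair_left[OF group_manifold manifold, of A "\<lambda>(g, q). l g q" x] action
  by (simp add: free_proper_action_def)

lemma smooth_act: "smooth_map A A (l g)"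
  using smooth_map_Pair_right[OF group_manifold manifold, of A "\<lambda>(g, q). l g q" g] action
  by (simp add: free_proper_action_def)

lemma smooth_conjugation: "smooth_map AG AG (\<lambda>h. g \<otimes> h \<otimes> inv g)"
proof -
  have m: "smooth_map (prod_atlas AG AG) AG (\<lambda>(g, h). g \<otimes> h)"
    using lie_group by (simp add: lie_group_def)
  have "smooth_map AG AG (\<lambda>h. h \<otimes> inv g)" "smooth_map AG AG (\<lambda>h. g \<otimes> h)"
    using smooth_map_Pair_left[OF group_manifold group_manifold m, of "inv g"]
      smooth_map_Pair_right[OF group_manifold group_manifold m, of g] by simp_all
  from smooth_map_on_compose[OF group_manifold group_manifold this(2,1)] show ?thesis by simp
qed

lemma smooth_fun_act_point: "smooth_fun A f \<Longrightarrow> smooth_fun AG (\<lambda>h. f (l h x))"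
  by (rule smooth_map_on_compose[OF group_manifold manifold smooth_act_point]) auto

lemma exp_zero [simp]: "\<xi> \<in> lie_algebra AG G \<Longrightarrow> ex (0 *\<^sub>R \<xi>) = \<one>"
proof -
  assume "\<xi> \<in> lie_algebra AG G"
  then have "ex ((0 + 0) *\<^sub>R \<xi>) = ex (0 *\<^sub>R \<xi>) \<otimes> ex (0 *\<^sub>R \<xi>)"
    using exponential unfolding exponential_map_def by blast
  then show ?thesis by simp
qed

lemma exp_uminus: "\<xi> \<in> lie_algebra AG G \<Longrightarrow> ex (t *\<^sub>R - \<xi>) = inv (ex (t *\<^sub>R \<xi>))"
proof -
  assume xi: "\<xi> \<in> lie_algebra AG G"
  then have "ex ((- t + t) *\<^sub>R \<xi>) = ex ((- t) *\<^sub>R \<xi>) \<otimes> ex (t *\<^sub>R \<xi>)"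
    using exponential unfolding exponential_map_def by blast
  then have "ex ((- t) *\<^sub>R \<xi>) \<otimes> ex (t *\<^sub>R \<xi>) = \<one>" using exp_zero[OF xi] by simp
  then show ?thesis using inv_equality by fastforce
qed

lemma lie_algebra_apply:
  assumes "\<xi> \<in> lie_algebra AG G" "smooth_fun AG f"
  shows "\<xi> f = deriv (\<lambda>t. f (ex (t *\<^sub>R \<xi>))) 0"
proof -
  have "velocity AG (\<lambda>t. ex (t *\<^sub>R \<xi>)) 0 = \<xi>"
    using exponential assms(1) unfolding exponential_map_def by blast
  from fun_cong[OF this, of f] show ?thesis using assms(2) by (simp add: velocity_def o_def)
qed

text \<open>A Lie algebra element is itself the velocity of its one-parameter subgroup, so that both sides are the
same derivative along that subgroup. Fundamental vector fields thereby become linear in \<open>\<xi>\<close>, and they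
are computed by applying \<open>\<xi>\<close> to functions on the group.\<close>

lemma generator_apply:
  assumes "\<xi> \<in> lie_algebra AG G" "smooth_fun A f"
  shows "generator A ex l \<xi> x f = \<xi> (\<lambda>h. f (l h x))"
  using lie_algebra_apply[OF assms(1) smooth_fun_act_point[OF assms(2)]] assms(2)
  by (simp add: generator_def velocity_def o_def)

lemma generator_not_smooth: "\<not> smooth_fun A f \<Longrightarrow> generator A ex l \<xi> x f = 0"
  by (simp add: generator_def velocity_def)

text \<open>The orbit curve of the one-parameter subgroup represents the generator and is smooth.\<close>

lemma generator_vertical:
  assumes xi: "\<xi> \<in> lie_algebra AG G"
  shows "generator A ex l \<xi> x \<in> vertical A G l x"
proof -
  have "smooth_map real_atlas AG (\<lambda>t. ex (t *\<^sub>R \<xi>))"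
    using exponential xi by (auto simp: exponential_map_def)
  from smooth_map_on_compose[OF smooth_manifold_real group_manifold this smooth_act_point]
  have "smooth_map real_atlas A (\<lambda>t. l (ex (t *\<^sub>R \<xi>)) x)" by simp
  then have "smooth_map_on {-1<..<1} real_atlas A (\<lambda>t. l (ex (t *\<^sub>R \<xi>)) x)"
    by (rule smooth_map_on_subset[OF smooth_manifold_real]) auto
  moreover have "l (ex (0 *\<^sub>R \<xi>)) x = x" using exp_zero[OF xi] by simp
  ultimately show ?thesis
    unfolding vertical_def tangent_subset_def generator_def
    by (intro CollectI exI[of _ "\<lambda>t. l (ex (t *\<^sub>R \<xi>)) x"] conjI exI[of _ 1])
      (auto simp: orbit_def)
qed

lemma adjoint_in_lie_algebra:
  "\<xi> \<in> lie_algebra AG G \<Longrightarrow> adjoint AG G g \<xi> \<in> lie_algebra AG G"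
  using tangent_map_in_tangent_space[OF group_manifold group_manifold smooth_conjugation, of \<xi> \<one> g]
  by (simp add: adjoint_def)

lemma adjoint_apply:
  "smooth_fun AG f \<Longrightarrow> adjoint AG G g \<xi> f = \<xi> (\<lambda>h. f (g \<otimes> h \<otimes> inv g))"
  by (simp add: adjoint_def tangent_map_def o_def)

text \<open>Conjugation turns \<open>h \<mapsto> h g x\<close> into \<open>h \<mapsto> g h x\<close>. Both the equivariance of fundamental vector fields and that of
\<open>\<psi>\<close> reduce to this identity.\<close>

lemma adjoint_apply_act:
  assumes "smooth_fun A f"
  shows "adjoint AG G g \<xi> (\<lambda>h. f (l h (l g x))) = \<xi> (\<lambda>h. f (l g (l h x)))"
  by (simp add: adjoint_apply[OF smooth_fun_act_point[OF assms]] act_mult)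

lemma generator_adjoint:
  assumes xi: "\<xi> \<in> lie_algebra AG G"
  shows "generator A ex l (adjoint AG G g \<xi>) (l g x) = tangent_map A A (l g) (generator A ex l \<xi> x)"
proof
  fix f
  show "generator A ex l (adjoint AG G g \<xi>) (l g x) f = tangent_map A A (l g) (generator A ex l \<xi> x) f"
  proof (cases "smooth_fun A f")
    case True
    have "smooth_fun A (\<lambda>y. f (l g y))"
      by (rule smooth_map_on_compose[OF manifold manifold smooth_act True]) simp
    then show ?thesis using True
      by (simp add: generator_apply adjoint_in_lie_algebra xi adjoint_apply_act tangent_map_def o_def)
  qed (simp add: generator_not_smooth tangent_map_def)
qed

lemma generator_diff:
  assumes "\<xi> \<in> lie_algebra AG G" "\<eta> \<in> lie_algebra AG G" "smooth_fun A f"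
  shows "generator A ex l (\<xi> - \<eta>) x f = generator A ex l \<xi> x f - generator A ex l \<eta> x f"
  using assms subspace_diff[OF subspace_tangent_space assms(1,2)] by (simp add: generator_apply)

lemma algebra_bundle_adjoint:
  assumes "invariant_bundle A l D" "\<xi> \<in> algebra_bundle A AG G ex l D x"
  shows "adjoint AG G g \<xi> \<in> algebra_bundle A AG G ex l D (l g x)"
proof -
  have "tangent_map A A (l g) (generator A ex l \<xi> x) \<in> D (l g x)"
    using assms by (auto simp: invariant_bundle_def algebra_bundle_def)
  then show ?thesis using assms(2)
    by (auto simp: algebra_bundle_def adjoint_in_lie_algebra generator_adjoint)
qed

end

section \<open>Invariant Lagrangians\<close>

locale invariant_lagrangian = lie_group_action E A EG AG G ex l
  for E :: "'e::euclidean_space set"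
    and A :: "('q::{t2_space,second_countable_topology}, 'e) chart set"
    and EG :: "'h::euclidean_space set"
    and AG :: "('g::{t2_space,second_countable_topology}, 'h) chart set"
    and G :: "'g monoid" (structure) and ex l +
  fixes L :: "'q \<times> 'q \<Rightarrow> real"
  assumes smooth_L: "smooth_fun (prod_atlas A A) L"
    and invariant_L: "\<And>g z. L (diagonal_action l g z) = L z"
begin

lemma L_act [simp]: "L (l g x, l g y) = L (x, y)"
  using invariant_L[of g "(x, y)"] by (simp add: diagonal_action_def)

lemma smooth_L_left: "smooth_fun A (\<lambda>x. L (x, y))"
  by (rule smooth_map_Pair_left[OF manifold manifold smooth_L])

lemma smooth_L_right: "smooth_fun A (\<lambda>y. L (x, y))"
  by (rule smooth_map_Pair_right[OF manifold manifold smooth_L])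

text \<open>The infinitesimal form of \<open>L(x, g y) = L(g\<^sup>-\<^sup>1 x, y)\<close> at the identity. Since
\<open>exp(t \<xi>)\<^sup>-\<^sup>1 = exp(t (- \<xi>))\<close>, the sign comes from the linearity of \<open>\<xi>\<close> as a functional rather than from a
reparametrization of the curve.\<close>

lemma invariance_derivative:
  assumes xi: "\<xi> \<in> lie_algebra AG G"
  shows "\<xi> (\<lambda>h. L (x, l h y)) = - \<xi> (\<lambda>h. L (l h x, y))"
proof -
  have mxi: "- \<xi> \<in> lie_algebra AG G" using subspace_neg[OF subspace_tangent_space xi] .
  have "L (x, l g y) = L (l (inv g) x, y)" for g
    using L_act[of "inv g" x "l g y"] by simp
  then have "deriv (\<lambda>t. L (x, l (ex (t *\<^sub>R \<xi>)) y)) 0 = deriv (\<lambda>t. L (l (ex (t *\<^sub>R - \<xi>)) x, y)) 0"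
    using exp_uminus[OF xi] by simp
  then have "\<xi> (\<lambda>h. L (x, l h y)) = (- \<xi>) (\<lambda>h. L (l h x, y))"
    using lie_algebra_apply[OF xi smooth_fun_act_point[OF smooth_L_right]]
      lie_algebra_apply[OF mxi smooth_fun_act_point[OF smooth_L_left]] by simp
  then show ?thesis by simp
qed

text \<open>The derivative of the action sum at the middle one of three consecutive points along the fundamental
vector field of \<open>\<xi>\<close>. All three conditions of the theorem are equivalent to its vanishing on the
fibres of \<open>\<gg>\<^sup>D\<close>.\<close>

definition vertical_defect :: "'q \<Rightarrow> 'q \<Rightarrow> 'q \<Rightarrow> 'g tangent \<Rightarrow> real"
  where "vertical_defect x y z \<xi> = \<xi> (\<lambda>h. L (x, l h y)) + \<xi> (\<lambda>h. L (l h y, z))"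

lemma vertical_defect_adjoint:
  "vertical_defect (l g x) (l g y) (l g z) (adjoint AG G g \<xi>) = vertical_defect x y z \<xi>"
  by (simp add: vertical_defect_def adjoint_apply_act[OF smooth_L_right] adjoint_apply_act[OF smooth_L_left])

end

section \<open>Equivariance of the discrete connection form\<close>

locale discrete_connection = lie_group_action E A EG AG G ex l
  for E :: "'e::euclidean_space set"
    and A :: "('q::{t2_space,second_countable_topology}, 'e) chart set"
    and EG :: "'h::euclidean_space set"
    and AG :: "('g::{t2_space,second_countable_topology}, 'h) chart set"
    and G :: "'g monoid" (structure) and ex l +
  fixes Hor U :: "('q \<times> 'q) set" and \<O> :: "('q set \<times> 'q set) set"
  assumes invariant_Hor: "invariant_set (diagonal_action l) Hor"
    and invariant_U: "invariant_set (diagonal_action l) U"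
    and unique_factor: "\<And>x y. (x, y) \<in> connection_domain G l \<O> \<Longrightarrow> \<exists>!g. (x, l (inv g) y) \<in> Hor \<inter> U"
begin

abbreviation \<A>d :: "'q \<Rightarrow> 'q \<Rightarrow> 'g"
  where "\<A>d \<equiv> discrete_connection_form G l Hor U"

lemma invariant_set_diagonal:
  assumes "invariant_set (diagonal_action l) S"
  shows "(l g x, l g y) \<in> S \<longleftrightarrow> (x, y) \<in> S"
proof
  have S: "diagonal_action l h z \<in> S" if "z \<in> S" for h z
    using assms that unfolding invariant_set_def by blast
  show "(l g x, l g y) \<in> S" if "(x, y) \<in> S"
    using S[OF that, of g] by (simp add: diagonal_action_def)
  show "(x, y) \<in> S" if "(l g x, l g y) \<in> S"
    using S[OF that, of "inv g"] by (simp add: diagonal_action_def)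
qed

lemma domain_act [simp]:
  "(l g x, l h y) \<in> connection_domain G l \<O> \<longleftrightarrow> (x, y) \<in> connection_domain G l \<O>"
  by (simp add: connection_domain_def)

lemma discrete_connection_eq_iff:
  assumes "(x, y) \<in> connection_domain G l \<O>"
  shows "\<A>d x y = g \<longleftrightarrow> (x, l (inv g) y) \<in> Hor \<inter> U"
  unfolding discrete_connection_form_def
  using theI'[OF unique_factor[OF assms]] the1_equality[OF unique_factor[OF assms], of g] by metis

lemma discrete_connection_act_right:
  assumes "(x, y) \<in> connection_domain G l \<O>"
  shows "\<A>d x (l g y) = g \<otimes> \<A>d x y"
proof -
  have "l (inv (g \<otimes> \<A>d x y)) (l g y) = l (inv (\<A>d x y)) y"
    by (simp add: inv_mult_group act_mult)
  moreover have "(x, l (inv (\<A>d x y)) y) \<in> Hor \<inter> U"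
    using discrete_connection_eq_iff[OF assms] by blast
  ultimately show ?thesis
    using discrete_connection_eq_iff[of x "l g y" "g \<otimes> \<A>d x y"] assms domain_act[of \<one> x g y] by simp
qed

lemma discrete_connection_equivariant:
  assumes "(x, y) \<in> connection_domain G l \<O>"
  shows "\<A>d (l g x) (l g y) = g \<otimes> \<A>d x y \<otimes> inv g"
proof -
  have "l (inv (g \<otimes> \<A>d x y \<otimes> inv g)) (l g y) = l g (l (inv (\<A>d x y)) y)"
    by (simp add: inv_mult_group act_mult)
  moreover have "(x, l (inv (\<A>d x y)) y) \<in> Hor \<inter> U"
    using discrete_connection_eq_iff[OF assms] by blast
  ultimately show ?thesis
    using discrete_connection_eq_iff[of "l g x" "l g y" "g \<otimes> \<A>d x y \<otimes> inv g"] assms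
    by (simp add: invariant_set_diagonal invariant_Hor invariant_U)
qed

text \<open>The horizontal lift moves a representative of the orbit back by its connection value; uniqueness
holds because the connection form is equivariant in its second argument along the fibre.\<close>

lemma discrete_lift_orbit:
  assumes "(x, y) \<in> connection_domain G l \<O>"
  shows "discrete_lift G l \<A>d x (orbit G l y) = l (inv (\<A>d x y)) y"
  unfolding discrete_lift_def
proof (rule the_equality)
  show "orbit G l (l (inv (\<A>d x y)) y) = orbit G l y \<and> \<A>d x (l (inv (\<A>d x y)) y) = \<one>"
    using discrete_connection_act_right[OF assms] by simp
  fix z assume z: "orbit G l z = orbit G l y \<and> \<A>d x z = \<one>"
  then have "z \<in> orbit G l y"
    using group_action.orbit_refl[OF group_action, of z] by simp
  then obtain h where h: "z = l h y" by (auto simp: orbit_def)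
  with z discrete_connection_act_right[OF assms, of h] have "h \<otimes> \<A>d x y = \<one>" by simp
  then show "z = l (inv (\<A>d x y)) y" using h inv_equality by fastforce
qed

lemma F1_discrete_connection:
  "(x, y) \<in> connection_domain G l \<O> \<Longrightarrow> F1 G l \<A>d x (\<A>d x y) (orbit G l y) = y"
  by (simp add: F1_def discrete_lift_orbit)

lemma rho_eq_iff: "rho G l x w = rho G l y w' \<longleftrightarrow> (\<exists>g. y = l g x \<and> w' = g \<otimes> w \<otimes> inv g)"
proof
  assume eq: "rho G l x w = rho G l y w'"
  have "(y, w') \<in> rho G l y w'"
    unfolding rho_def orbit_def by (intro CollectI exI[of _ \<one>]) simp
  then show "\<exists>g. y = l g x \<and> w' = g \<otimes> w \<otimes> inv g"
    unfolding eq[symmetric] by (auto simp: rho_def orbit_def)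
next
  assume "\<exists>g. y = l g x \<and> w' = g \<otimes> w \<otimes> inv g"
  then obtain g where g: "y = l g x" "w' = g \<otimes> w \<otimes> inv g" by blast
  have "inv g \<otimes> (g \<otimes> k) = k" for k by (simp flip: m_assoc)
  then have "(l h x, h \<otimes> w \<otimes> inv h) = (l (h \<otimes> inv g) y, (h \<otimes> inv g) \<otimes> w' \<otimes> inv (h \<otimes> inv g))"
    and "(l h y, h \<otimes> w' \<otimes> inv h) = (l (h \<otimes> g) x, (h \<otimes> g) \<otimes> w \<otimes> inv (h \<otimes> g))" for h
    by (simp_all add: g act_mult inv_mult_group m_assoc)
  then show "rho G l x w = rho G l y w'"
    unfolding rho_def orbit_def by auto
qed

text \<open>Freeness of the action makes the group component over a fixed base point unique.\<close>

lemma rho_inj: "rho G l x w = rho G l x w' \<longleftrightarrow> w = w'"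
proof
  assume "rho G l x w = rho G l x w'"
  then obtain g where g: "x = l g x" "w' = g \<otimes> w \<otimes> inv g" by (auto simp: rho_eq_iff)
  then have "g = \<one>" using act_free[of \<one> x g] by simp
  then show "w = w'" using g by simp
qed simp

lemma rho_discrete_connection_act:
  assumes "(x, y) \<in> connection_domain G l \<O>"
  shows "rho G l (l g x) (\<A>d (l g x) (l g y)) = rho G l x (\<A>d x y)"
  using discrete_connection_equivariant[OF assms, of g] by (metis rho_eq_iff)

end

section \<open>The intrinsic vertical condition\<close>

locale discrete_system =
  discrete_connection E A EG AG G ex l Hor U \<O> + invariant_lagrangian E A EG AG G ex l L
  for E :: "'e::euclidean_space set"
    and A :: "('q::{t2_space,second_countable_topology}, 'e) chart set"
    and EG :: "'h::euclidean_space set"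
    and AG :: "('g::{t2_space,second_countable_topology}, 'h) chart set"
    and G :: "'g monoid" (structure) and ex l Hor U \<O> L
begin

text \<open>The point of the reduced second-order space that is represented by three consecutive points of a
discrete curve.\<close>

definition reduced_tuple :: "'q \<Rightarrow> 'q \<Rightarrow> 'q \<Rightarrow> 'g tangent \<Rightarrow> ('q, 'g) reduced_tuple"
  where "reduced_tuple x y z \<xi> =
    (x, \<A>d x y, orbit G l y, rho G l y (\<A>d y z), orbit G l z, \<xi>)"

text \<open>Right translation by \<open>w = \<A>\<^sub>d(x, y)\<close> turns variations of the group variable at \<open>w\<close> into the variations \<open>h y\<close>
of the second point, because \<open>h w\<close> carries the horizontal lift to \<open>h y\<close>.\<close>

lemma right_translate_D2_check_L:
  assumes "(x, y) \<in> connection_domain G l \<O>"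
  shows "right_translate AG G (\<A>d x y) (D2_check_L G l \<A>d L x (orbit G l y)) \<xi> = \<xi> (\<lambda>h. L (x, l h y))"
proof -
  have "check_L G l \<A>d L x w (orbit G l y) = L (x, l w (l (inv (\<A>d x y)) y))" for w
    by (simp add: check_L_def F1_def discrete_lift_orbit[OF assms])
  then show ?thesis
    by (simp add: right_translate_def D2_check_L_def tangent_map_def o_def act_mult
        smooth_fun_act_point[OF smooth_L_right])
qed

text \<open>The second covector is a derivative of \<open>L(y, z)\<close> in \<open>z\<close>; the invariance of the Lagrangian moves it to \<open>y\<close> at
the cost of a sign.\<close>

lemma psi_check_reduced_tuple:
  assumes xy: "(x, y) \<in> connection_domain G l \<O>" and yz: "(y, z) \<in> connection_domain G l \<O>"
    and xi: "\<xi> \<in> lie_algebra AG G"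
  shows "psi_check AG G l \<A>d L (reduced_tuple x y z \<xi>) = vertical_defect x y z \<xi>"
proof -
  have "(THE w. rho G l y w = rho G l y (\<A>d y z)) = \<A>d y z" by (simp add: rho_inj)
  then show ?thesis
    by (simp add: psi_check_def reduced_tuple_def F1_discrete_connection[OF xy]
        right_translate_D2_check_L xy yz vertical_defect_def invariance_derivative[OF xi, of y])
qed

lemma tuple_action_reduced_tuple:
  assumes "(x, y) \<in> connection_domain G l \<O>" "(y, z) \<in> connection_domain G l \<O>"
  shows "tuple_action AG G l g (reduced_tuple x y z \<xi>) =
    reduced_tuple (l g x) (l g y) (l g z) (adjoint AG G g \<xi>)"
  using assms
  by (simp add: tuple_action_def reduced_tuple_def discrete_connection_equivariant[OF assms(1)]
      rho_discrete_connection_act)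

text \<open>The orbit of the tuple consists of the tuples of the translated points, on which \<open>\<psi>\<close> takes the same value.\<close>

lemma psi_bar_reduced_tuple:
  assumes xy: "(x, y) \<in> connection_domain G l \<O>" and yz: "(y, z) \<in> connection_domain G l \<O>"
    and xi: "\<xi> \<in> lie_algebra AG G"
  shows "psi_bar AG G l \<A>d L (orbit G (tuple_action AG G l) (reduced_tuple x y z \<xi>)) =
    vertical_defect x y z \<xi>"
proof -
  have "psi_check AG G l \<A>d L (tuple_action AG G l g (reduced_tuple x y z \<xi>)) = vertical_defect x y z \<xi>" for g
    using assms
    by (simp add: tuple_action_reduced_tuple psi_check_reduced_tuple adjoint_in_lie_algebra vertical_defect_adjoint)
  moreover have "orbit G (tuple_action AG G l) t = range (\<lambda>g. tuple_action AG G l g t)" for t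
    by (auto simp only: orbit_def carrier_UNIV)
  ultimately show ?thesis unfolding psi_bar_def
    by (intro the_equality) simp_all
qed

text \<open>The condition ranges over all representatives of the reduced point, that is over all translates of
the three points. The adjoint action maps the fibres of \<open>\<gg>\<^sup>D\<close> at translated points to each other and
preserves the defect, so that a single representative suffices.\<close>

lemma vertical_condition_iff:
  assumes xy: "(x, y) \<in> connection_domain G l \<O>" and yz: "(y, z) \<in> connection_domain G l \<O>"
    and D: "invariant_bundle A l D"
  shows "vertical_condition A AG G ex l D \<A>d L (rho G l x (\<A>d x y)) (orbit G l y)
      (rho G l y (\<A>d y z)) (orbit G l z) \<longleftrightarrow>
    (\<forall>\<xi>\<in>algebra_bundle A AG G ex l D y. vertical_defect x y z \<xi> = 0)"
proof -
  have F1: "F1 G l \<A>d (l g x) (\<A>d (l g x) (l g y)) (orbit G l y) = l g y" for g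
    using F1_discrete_connection[of "l g x" "l g y"] xy by simp
  have psi: "psi_bar AG G l \<A>d L (orbit G (tuple_action AG G l) (l g x, \<A>d (l g x) (l g y), orbit G l y,
      rho G l y (\<A>d y z), orbit G l z, \<xi>)) = vertical_defect (l g x) (l g y) (l g z) \<xi>"
    if "\<xi> \<in> lie_algebra AG G" for g \<xi>
    using psi_bar_reduced_tuple[of "l g x" "l g y" "l g z" \<xi>] xy yz that
    by (simp add: reduced_tuple_def rho_discrete_connection_act)
  have rep: "rho G l x' w = rho G l x (\<A>d x y) \<longleftrightarrow> (\<exists>g. x' = l g x \<and> w = \<A>d (l g x) (l g y))" for x' w
    using rho_eq_iff[of x "\<A>d x y" x' w] discrete_connection_equivariant[OF xy] by auto
  have "vertical_condition A AG G ex l D \<A>d L (rho G l x (\<A>d x y)) (orbit G l y)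
      (rho G l y (\<A>d y z)) (orbit G l z) \<longleftrightarrow>
    (\<forall>g. \<forall>\<xi>\<in>algebra_bundle A AG G ex l D (l g y). psi_bar AG G l \<A>d L (orbit G (tuple_action AG G l)
      (l g x, \<A>d (l g x) (l g y), orbit G l y, rho G l y (\<A>d y z), orbit G l z, \<xi>)) = 0)"
    \<comment> \<open>at the representative translated by \<open>g\<close>, the point \<open>F\<^sub>1\<close> is \<open>g y\<close>\<close>
    unfolding vertical_condition_def rep using F1 by (auto simp only: ball_simps) metis+
  also have "\<dots> \<longleftrightarrow> (\<forall>g. \<forall>\<xi>\<in>algebra_bundle A AG G ex l D (l g y).
      vertical_defect (l g x) (l g y) (l g z) \<xi> = 0)"
    using psi by (auto simp: algebra_bundle_def)
  also have "\<dots> \<longleftrightarrow> (\<forall>\<xi>\<in>algebra_bundle A AG G ex l D y. vertical_defect x y z \<xi> = 0)"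
  proof safe
    fix \<xi> assume "\<forall>g. \<forall>\<xi>\<in>algebra_bundle A AG G ex l D (l g y). vertical_defect (l g x) (l g y) (l g z) \<xi> = 0"
      and "\<xi> \<in> algebra_bundle A AG G ex l D y"
    from this(1)[rule_format, of \<xi> \<one>] this(2) show "vertical_defect x y z \<xi> = 0" by simp
  next
    fix g \<xi> assume *: "\<forall>\<xi>\<in>algebra_bundle A AG G ex l D y. vertical_defect x y z \<xi> = 0"
      and xi: "\<xi> \<in> algebra_bundle A AG G ex l D (l g y)"
    have "adjoint AG G (inv g) \<xi> \<in> algebra_bundle A AG G ex l D y"
      using algebra_bundle_adjoint[OF D xi, of "inv g"] by simp
    then have "vertical_defect x y z (adjoint AG G (inv g) \<xi>) = 0" using * by blast
    then show "vertical_defect (l g x) (l g y) (l g z) \<xi> = 0"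
      using vertical_defect_adjoint[of "inv g" "l g x" "l g y" "l g z" \<xi>] by simp
  qed
  finally show ?thesis .
qed

end

section \<open>The vertical variational principle\<close>

lemma action_sum_update:
  assumes "0 < k" "k < N"
  shows "action_sum L N (q(k := x)) =
    L (q (k - 1), x) + (L (x, q (k + 1)) + (\<Sum>j\<in>{..<N} - {k - 1, k}. L (q j, q (Suc j))))"
proof -
  let ?f = "\<lambda>j. L ((q(k := x)) j, (q(k := x)) (Suc j))"
  have "{..<N} = insert (k - 1) (insert k ({..<N} - {k - 1, k}))" using assms by auto
  then have "sum ?f {..<N} = sum ?f (insert (k - 1) (insert k ({..<N} - {k - 1, k})))" by simp
  also have "\<dots> = ?f (k - 1) + (?f k + sum ?f ({..<N} - {k - 1, k}))"
    using assms by (subst sum.insert; simp)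
  also have "sum ?f ({..<N} - {k - 1, k}) = (\<Sum>j\<in>{..<N} - {k - 1, k}. L (q j, q (Suc j)))"
    using assms by (intro sum.cong) auto
  finally have "sum ?f {..<N} = ?f (k - 1) + (?f k + (\<Sum>j\<in>{..<N} - {k - 1, k}. L (q j, q (Suc j))))" .
  moreover have "k - 1 \<noteq> k" "Suc (k - 1) = k" using assms by auto
  ultimately show ?thesis by (simp add: action_sum_def)
qed

lemma d_action_sum_vanishing_ends:
  assumes A: "smooth_manifold E A" and L: "smooth_fun (prod_atlas A A) L"
    and \<delta>: "\<And>k. k \<le> N \<Longrightarrow> \<delta> k \<in> tangent_space A (q k)" and ends: "\<delta> 0 = 0" "\<delta> N = 0"
  shows "d_action_sum L N q \<delta> =
    (\<Sum>k\<in>{1..N - 1}. \<delta> k (\<lambda>x. L (q (k - 1), x)) + \<delta> k (\<lambda>x. L (x, q (k + 1))))"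
proof -
  have "d_action_sum L N q \<delta> = (\<Sum>k\<in>{1..N - 1}. \<delta> k (\<lambda>x. action_sum L N (q(k := x))))"
    unfolding d_action_sum_def
  proof (rule sum.mono_neutral_right)
    show "\<forall>k\<in>{..N} - {1..N - 1}. \<delta> k (\<lambda>x. action_sum L N (q(k := x))) = 0"
    proof
      fix k assume "k \<in> {..N} - {1..N - 1}"
      then have "k = 0 \<or> k = N" by auto
      then show "\<delta> k (\<lambda>x. action_sum L N (q(k := x))) = 0" using ends by auto
    qed
  qed auto
  also have "\<dots> = (\<Sum>k\<in>{1..N - 1}. \<delta> k (\<lambda>x. L (q (k - 1), x)) + \<delta> k (\<lambda>x. L (x, q (k + 1))))"
  proof (rule sum.cong)
    fix k assume k: "k \<in> {1..N - 1}"
    then have T: "\<delta> k \<in> tangent_space A (q k)" by (intro \<delta>) auto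
    note add = tangent_spaceD(1)[OF T] and const = smooth_map_on_const[OF A open_UNIV]
    note left = smooth_map_Pair_left[OF A A L] and right = smooth_map_Pair_right[OF A A L]
    have "action_sum L N (q(k := x)) =
        L (q (k - 1), x) + (L (x, q (k + 1)) + (\<Sum>j\<in>{..<N} - {k - 1, k}. L (q j, q (Suc j))))" for x
      using k by (intro action_sum_update) auto
    then show "\<delta> k (\<lambda>x. action_sum L N (q(k := x))) =
        \<delta> k (\<lambda>x. L (q (k - 1), x)) + \<delta> k (\<lambda>x. L (x, q (k + 1)))"
      by (simp add: add[OF right smooth_map_on_add[OF A left const]] add[OF left const]
          tangent_const[OF A T])
  qed simp
  finally show ?thesis .
qed

text \<open>Variations at different times are independent, so that the principle may be tested on variations
that are supported at a single time.\<close>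

lemma vertical_variational_principle_iff:
  assumes A: "smooth_manifold E A" and L: "smooth_fun (prod_atlas A A) L"
    and S: "\<And>x. S x \<subseteq> tangent_space A x" and zero: "\<And>x. 0 \<in> S x"
  shows "(\<forall>\<delta>. (\<forall>k\<le>N. \<delta> k \<in> S (q k)) \<and> \<delta> 0 = 0 \<and> \<delta> N = 0 \<longrightarrow> d_action_sum L N q \<delta> = 0) \<longleftrightarrow>
    (\<forall>k\<in>{1..N - 1}. \<forall>v\<in>S (q k). v (\<lambda>x. L (q (k - 1), x)) + v (\<lambda>x. L (x, q (k + 1))) = 0)"
    (is "?principle \<longleftrightarrow> ?pointwise")
proof
  assume principle: ?principle
  show ?pointwise
  proof (intro ballI)
    fix k v assume k: "k \<in> {1..N - 1}" and v: "v \<in> S (q k)"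
    define \<delta> where "\<delta> = (\<lambda>j. if j = k then v else 0)"
    have \<delta>: "\<delta> j \<in> S (q j)" "\<delta> 0 = 0" "\<delta> N = 0" for j using k v zero by (auto simp: \<delta>_def)
    with principle have "d_action_sum L N q \<delta> = 0" by blast
    also have "d_action_sum L N q \<delta> =
        (\<Sum>j\<in>{1..N - 1}. \<delta> j (\<lambda>x. L (q (j - 1), x)) + \<delta> j (\<lambda>x. L (x, q (j + 1))))"
      by (rule d_action_sum_vanishing_ends[OF A L subsetD[OF S \<delta>(1)] \<delta>(2,3)])
    also have "\<dots> = (\<Sum>j\<in>{1..N - 1}. if j = k then v (\<lambda>x. L (q (k - 1), x)) + v (\<lambda>x. L (x, q (k + 1))) else 0)"
      by (rule sum.cong) (auto simp: \<delta>_def)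
    finally show "v (\<lambda>x. L (q (k - 1), x)) + v (\<lambda>x. L (x, q (k + 1))) = 0"
      using k by simp
  qed
next
  assume pointwise: ?pointwise
  show ?principle
  proof (intro allI impI)
    fix \<delta> assume \<delta>: "(\<forall>k\<le>N. \<delta> k \<in> S (q k)) \<and> \<delta> 0 = 0 \<and> \<delta> N = 0"
    then have "d_action_sum L N q \<delta> =
        (\<Sum>k\<in>{1..N - 1}. \<delta> k (\<lambda>x. L (q (k - 1), x)) + \<delta> k (\<lambda>x. L (x, q (k + 1))))"
      by (intro d_action_sum_vanishing_ends[OF A L subsetD[OF S]]) auto
    also have "\<dots> = 0"
      using pointwise \<delta> by (intro sum.neutral) auto
    finally show "d_action_sum L N q \<delta> = 0" .
  qed
qed

section \<open>Vertical distributions as bundles of generators\<close>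

locale nonholonomic_connection = lie_group_action E A EG AG G ex l
  for E :: "'e::euclidean_space set"
    and A :: "('q::{t2_space,second_countable_topology}, 'e) chart set"
    and EG :: "'h::euclidean_space set"
    and AG :: "('g::{t2_space,second_countable_topology}, 'h) chart set"
    and G :: "'g monoid" (structure) and ex l +
  fixes D \<S> \<H> \<U> \<W> :: "'q \<Rightarrow> 'q tangent set"
    and \<A> :: "'q \<Rightarrow> 'q tangent \<Rightarrow> 'g tangent"
  assumes subbundle_D: "subbundle A D"
    and vertical_part: "\<And>x. \<S> x = vertical A G l x \<inter> D x"
    and D_sum: "\<And>x. direct_sum (D x) [\<S> x, \<H> x]"
    and vertical_sum: "\<And>x. direct_sum (vertical A G l x) [\<S> x, \<U> x]"
    and tangent_sum: "\<And>x. direct_sum (tangent_space A x) [\<W> x, \<U> x, \<S> x, \<H> x]"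
    and connection: "principal_connection A AG G ex l (\<lambda>x. {a + b | a b. a \<in> \<W> x \<and> b \<in> \<H> x}) \<A>"
begin

lemmas subspaces = direct_sum4D(3-6)[OF tangent_sum]
lemmas zeros = subspaces[THEN subspace_0]

lemma vertical_subset: "vertical A G l x \<subseteq> tangent_space A x"
proof
  fix v assume "v \<in> vertical A G l x"
  then obtain s u where su: "s \<in> \<S> x" "u \<in> \<U> x" "v = s + u"
    using direct_sum2D(3)[OF vertical_sum[of x]] by auto
  then show "v \<in> tangent_space A x"
    using direct_sum4D(1)[OF tangent_sum[of x] zeros(1) su(2,1) zeros(4)] by (simp add: add.commute)
qed

lemma subspace_vertical: "subspace (vertical A G l x)"
  unfolding direct_sum2D(3)[OF vertical_sum[of x]]
  by (rule subspace_sums[OF direct_sum2D(1,2)[OF vertical_sum[of x]]])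

lemma \<S>_subset: "\<S> x \<subseteq> tangent_space A x"
  using vertical_part vertical_subset by blast

lemmas connection_conjuncts = connection[unfolded principal_connection_def]

lemmas connection_in_lie_algebra = connection_conjuncts[THEN conjunct1, rule_format]
  and connection_add = connection_conjuncts[THEN conjunct2, THEN conjunct1, rule_format]
  and connection_smooth =
    connection_conjuncts[THEN conjunct2, THEN conjunct2, THEN conjunct2, THEN conjunct1, rule_format]
  and connection_generator =
    connection_conjuncts[THEN conjunct2, THEN conjunct2, THEN conjunct2, THEN conjunct2, THEN conjunct1, rule_format]
  and connection_kernel =
    connection_conjuncts[THEN conjunct2, THEN conjunct2, THEN conjunct2, THEN conjunct2, THEN conjunct2,
      THEN conjunct2, rule_format]

lemma connection_horizontal:
  "v \<in> tangent_space A x \<and> \<A> x v = 0 \<longleftrightarrow> (\<exists>a b. v = a + b \<and> a \<in> \<W> x \<and> b \<in> \<H> x)"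
  using eqset_imp_iff[OF connection_kernel, of v x] by simp

text \<open>The difference between a vertical vector and the generator of its connection value is both vertical
and horizontal: it lies in \<open>\<S> + \<U>\<close> and in \<open>\<W> + \<H>\<close>, and vanishes since \<open>\<W> \<oplus> \<U> \<oplus> \<S> \<oplus> \<H>\<close> is direct. Hence every vertical
vector is a generator.\<close>

lemma generator_connection:
  assumes v: "v \<in> vertical A G l x"
  shows "generator A ex l (\<A> x v) x = v"
proof -
  define g where "g = generator A ex l (\<A> x v) x"
  have xi: "\<A> x v \<in> lie_algebra AG G" using connection_in_lie_algebra v vertical_subset by blast
  have g: "g \<in> vertical A G l x" unfolding g_def by (rule generator_vertical[OF xi])
  have vg: "v - g \<in> vertical A G l x" using subspace_diff[OF subspace_vertical v g] .
  have "\<A> x ((v - g) + g) = \<A> x (v - g) + \<A> x g"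
    using vg g vertical_subset by (intro connection_add) blast+
  then have "\<A> x (v - g) = 0" using connection_generator[OF xi] by (simp add: g_def)
  then obtain a b where ab: "v - g = a + b" "a \<in> \<W> x" "b \<in> \<H> x"
    using connection_horizontal vg vertical_subset by blast
  obtain s u where su: "v - g = s + u" "s \<in> \<S> x" "u \<in> \<U> x"
    using vg direct_sum2D(3)[OF vertical_sum[of x]] by auto
  have "0 = a \<and> u = 0 \<and> s = 0 \<and> 0 = b"
    by (rule direct_sum4D(2)[OF tangent_sum[of x]]) (use ab su zeros in \<open>simp_all add: add.commute\<close>)
  then have "v - g = 0" using su by simp
  then show ?thesis by (simp add: g_def)
qed

lemma \<S>_eq_generators: "\<S> x = (\<lambda>\<xi>. generator A ex l \<xi> x) ` algebra_bundle A AG G ex l D x"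
proof
  show "\<S> x \<subseteq> (\<lambda>\<xi>. generator A ex l \<xi> x) ` algebra_bundle A AG G ex l D x"
  proof
    fix v assume "v \<in> \<S> x"
    then have v: "v \<in> vertical A G l x" "v \<in> D x" using vertical_part by auto
    then have "\<A> x v \<in> algebra_bundle A AG G ex l D x"
      using connection_in_lie_algebra vertical_subset generator_connection by (auto simp: algebra_bundle_def)
    then show "v \<in> (\<lambda>\<xi>. generator A ex l \<xi> x) ` algebra_bundle A AG G ex l D x"
      using generator_connection[OF v(1)] by (metis image_eqI)
  qed
  show "(\<lambda>\<xi>. generator A ex l \<xi> x) ` algebra_bundle A AG G ex l D x \<subseteq> \<S> x"
    using vertical_part generator_vertical by (auto simp: algebra_bundle_def)
qed

text \<open>As \<open>\<H>\<close> is horizontal, the connection sees only the \<open>\<S>\<close>-component of a vector of \<open>D = \<S> \<oplus> \<H>\<close>.\<close>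

lemma connection_D_in_algebra_bundle:
  assumes d: "d \<in> D x"
  shows "\<A> x d \<in> algebra_bundle A AG G ex l D x"
proof -
  obtain s h where sh: "d = s + h" "s \<in> \<S> x" "h \<in> \<H> x"
    using d direct_sum2D(3)[OF D_sum[of x]] by auto
  have h: "h \<in> tangent_space A x \<and> \<A> x h = 0"
    unfolding connection_horizontal using sh(3) zeros(1) by (intro exI[of _ 0] exI[of _ h]) simp
  have "\<A> x d = \<A> x s + \<A> x h"
    unfolding sh(1) using h sh(2) \<S>_subset by (intro connection_add) auto
  then have "\<A> x d = \<A> x s" using h by simp
  moreover obtain \<xi> where \<xi>: "\<xi> \<in> algebra_bundle A AG G ex l D x" "s = generator A ex l \<xi> x"
    using sh(2) \<S>_eq_generators by auto
  ultimately show ?thesis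
    using connection_generator[of \<xi> x] by (auto simp: algebra_bundle_def)
qed

text \<open>The generator of \<open>\<xi>\<close> is extended to a global section of \<open>D\<close>, not of the intersection \<open>\<S>\<close>: smooth frames are
given for \<open>D\<close>, and the smooth connection form removes the \<open>\<H>\<close>-component that the extension may acquire.\<close>

lemma algebra_section_through:
  assumes "\<xi> \<in> algebra_bundle A AG G ex l D p"
  obtains \<zeta> where "algebra_section A AG G ex l D \<zeta>" "\<zeta> p = \<xi>"
proof -
  have xi: "\<xi> \<in> lie_algebra AG G" "generator A ex l \<xi> p \<in> D p"
    using assms by (auto simp: algebra_bundle_def)
  obtain X where X: "smooth_vector_field_on UNIV A X" "\<And>x. X x \<in> D x" "X p = generator A ex l \<xi> p"
    using smooth_section_through[OF manifold subbundle_D xi(2)] by blast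
  show thesis
  proof (rule that[of "\<lambda>x. \<A> x (X x)"])
    show "algebra_section A AG G ex l D (\<lambda>x. \<A> x (X x))"
      using connection_smooth[OF X(1)] connection_D_in_algebra_bundle X(2)
      by (simp add: algebra_section_def)
    show "\<A> p (X p) = \<xi>" using X(3) connection_generator[OF xi(1)] by simp
  qed
qed

end

section \<open>Evolution of the momentum map\<close>

context invariant_lagrangian
begin

lemma vertical_defect_generator:
  "\<xi> \<in> lie_algebra AG G \<Longrightarrow> vertical_defect x y z \<xi> =
    generator A ex l \<xi> y (\<lambda>u. L (x, u)) + generator A ex l \<xi> y (\<lambda>u. L (u, z))"
  by (simp add: vertical_defect_def generator_apply smooth_L_left smooth_L_right)

text \<open>The terms with \<open>\<zeta>(x)\<close> cancel by linearity, and invariance rewrites the remaining derivative of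
\<open>L(x, y)\<close> in \<open>x\<close> along \<open>\<zeta>(y)\<close> as one in \<open>y\<close>.\<close>

lemma momentum_evolution_iff:
  assumes \<zeta>: "\<zeta> x \<in> lie_algebra AG G" "\<zeta> y \<in> lie_algebra AG G"
  shows "momentum_section A ex l L \<zeta> y z - momentum_section A ex l L \<zeta> x y =
      - D1 L x y (generator A ex l (\<zeta> y - \<zeta> x) x) \<longleftrightarrow>
    vertical_defect x y z (\<zeta> y) = 0"
proof -
  have "generator A ex l (\<zeta> y) x (\<lambda>u. L (u, y)) = - \<zeta> y (\<lambda>h. L (x, l h y))"
    using invariance_derivative[OF \<zeta>(2)] by (simp add: generator_apply \<zeta> smooth_L_left)
  then show ?thesis
    by (auto simp: momentum_section_def momentum_def D1_def generator_diff \<zeta> smooth_L_left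
        vertical_defect_def generator_apply)
qed

end

theorem theorem8p5:
  fixes E :: "'e::euclidean_space set"
    and A :: "('q::{t2_space,second_countable_topology}, 'e) chart set"
    and L :: "'q \<times> 'q \<Rightarrow> real"
    and D :: "'q \<Rightarrow> 'q tangent set"
    and Dd :: "('q \<times> 'q) set"
    and EG :: "'h::euclidean_space set"
    and AG :: "('g::{t2_space,second_countable_topology}, 'h) chart set"
    and G :: "'g monoid"
    and ex :: "'g tangent \<Rightarrow> 'g"
    and l :: "'g \<Rightarrow> 'q \<Rightarrow> 'q"
    and \<S> \<H> \<U> \<W> :: "'q \<Rightarrow> 'q tangent set"
    and \<A> :: "'q \<Rightarrow> 'q tangent \<Rightarrow> 'g tangent"
    and \<gamma> :: "'q \<Rightarrow> 'g"
    and Hor U :: "('q \<times> 'q) set"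
    and \<O> :: "('q set \<times> 'q set) set"
    and \<A>d :: "'q \<Rightarrow> 'q \<Rightarrow> 'g"
    and N :: nat
    and q :: "nat \<Rightarrow> 'q"
    and r :: "nat \<Rightarrow> 'q set"
    and w :: "nat \<Rightarrow> 'g"
    and v :: "nat \<Rightarrow> ('q \<times> 'g) set"
  assumes "nonholonomic_system E A L D Dd"
    and "lie_group EG AG G"
    and "exponential_map AG G ex"
    and "symmetry_group A L D Dd AG G l"
    and "\<And>x. \<S> x = vertical A G l x \<inter> D x"
    and "locally_constant_rank \<S>"
    and "subbundle A \<H>" and "invariant_bundle A l \<H>"
    and "subbundle A \<U>" and "invariant_bundle A l \<U>"
    and "subbundle A \<W>" and "invariant_bundle A l \<W>"
    and "\<And>x. direct_sum (D x) [\<S> x, \<H> x]"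
    and "\<And>x. direct_sum (vertical A G l x) [\<S> x, \<U> x]"
    and "\<And>x. direct_sum (tangent_space A x) [\<W> x, \<U> x, \<S> x, \<H> x]"
    and "principal_connection A AG G ex l (\<lambda>x. {a + b | a b. a \<in> \<W> x \<and> b \<in> \<H> x}) \<A>"
    and "affine_discrete_connection E A AG G l \<gamma> Hor"
    and "connection_neighbourhoods A AG G l \<gamma> Hor U \<O>"
    and "\<A>d = discrete_connection_form G l Hor U"
    and "\<And>k. k < N \<Longrightarrow> (q k, q (Suc k)) \<in> connection_domain G l \<O>"
    and "\<And>k. k \<le> N \<Longrightarrow> r k = orbit G l (q k)"
    and "\<And>k. k < N \<Longrightarrow> w k = \<A>d (q k) (q (Suc k))"
    and "\<And>k. k < N \<Longrightarrow> v k = rho G l (q k) (w k)"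
  shows "((\<forall>\<delta>. (\<forall>k\<le>N. \<delta> k \<in> \<S> (q k)) \<and> \<delta> 0 = 0 \<and> \<delta> N = 0 \<longrightarrow> d_action_sum L N q \<delta> = 0) \<longleftrightarrow>
          (\<forall>k\<in>{1..N - 1}.
            vertical_condition A AG G ex l D \<A>d L (v (k - 1)) (r k) (v k) (r (k + 1))))
      \<and> ((\<forall>k\<in>{1..N - 1}.
            vertical_condition A AG G ex l D \<A>d L (v (k - 1)) (r k) (v k) (r (k + 1))) \<longleftrightarrow>
          (\<forall>\<xi>. algebra_section A AG G ex l D \<xi> \<longrightarrow> (\<forall>k\<in>{1..N - 1}.
            momentum_section A ex l L \<xi> (q k) (q (k + 1)) -
            momentum_section A ex l L \<xi> (q (k - 1)) (q k) =
            - D1 L (q (k - 1)) (q k) (generator A ex l (\<xi> (q k) - \<xi> (q (k - 1))) (q (k - 1))))))"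
proof -
  have manifold: "smooth_manifold E A" and smooth_L: "smooth_fun (prod_atlas A A) L" and D: "subbundle A D"
    using assms(1) by (simp_all add: nonholonomic_system_def)
  have act: "free_proper_action A AG G l" and L_inv: "\<And>g z. L (diagonal_action l g z) = L z"
    and D_inv: "invariant_bundle A l D"
    using assms(4) unfolding symmetry_group_def by blast+
  interpret nonholonomic_connection E A EG AG G ex l D \<S> \<H> \<U> \<W> \<A>
    by unfold_locales (fact manifold assms act D)+
  interpret discrete_system E A EG AG G ex l Hor U \<O> L
    using assms(17,18) smooth_L L_inv
    by unfold_locales (auto simp: affine_discrete_connection_def connection_neighbourhoods_def)
  let ?criterion = "\<forall>k\<in>{1..N - 1}. \<forall>\<xi>\<in>algebra_bundle A AG G ex l D (q k).
    vertical_defect (q (k - 1)) (q k) (q (k + 1)) \<xi> = 0"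
  have one: "(\<forall>\<delta>. (\<forall>k\<le>N. \<delta> k \<in> \<S> (q k)) \<and> \<delta> 0 = 0 \<and> \<delta> N = 0 \<longrightarrow> d_action_sum L N q \<delta> = 0) \<longleftrightarrow> ?criterion"
    unfolding vertical_variational_principle_iff[where S = \<S>, OF manifold smooth_L \<S>_subset zeros(3)]
    unfolding \<S>_eq_generators by (auto simp: vertical_defect_generator algebra_bundle_def)
  have two: "(\<forall>k\<in>{1..N - 1}.
      vertical_condition A AG G ex l D \<A>d L (v (k - 1)) (r k) (v k) (r (k + 1))) \<longleftrightarrow> ?criterion"
  proof (rule ball_cong)
    fix k assume "k \<in> {1..N - 1}"
    then have k: "k - 1 < N" "k < N" "Suc (k - 1) = k" "k \<le> N" "k + 1 \<le> N" by auto
    show "vertical_condition A AG G ex l D \<A>d L (v (k - 1)) (r k) (v k) (r (k + 1)) \<longleftrightarrow>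
        (\<forall>\<xi>\<in>algebra_bundle A AG G ex l D (q k). vertical_defect (q (k - 1)) (q k) (q (k + 1)) \<xi> = 0)"
      using vertical_condition_iff[OF _ _ D_inv, of "q (k - 1)" "q k" "q (k + 1)"]
        assms(20)[OF k(1)] assms(20)[OF k(2)] assms(21)[OF k(4)] assms(21)[OF k(5)]
        assms(22)[OF k(1)] assms(22)[OF k(2)] assms(23)[OF k(1)] assms(23)[OF k(2)] assms(19) k(3)
      by simp
  qed simp
  have three: "(\<forall>\<xi>. algebra_section A AG G ex l D \<xi> \<longrightarrow> (\<forall>k\<in>{1..N - 1}.
      momentum_section A ex l L \<xi> (q k) (q (k + 1)) - momentum_section A ex l L \<xi> (q (k - 1)) (q k) =
      - D1 L (q (k - 1)) (q k) (generator A ex l (\<xi> (q k) - \<xi> (q (k - 1))) (q (k - 1))))) \<longleftrightarrow> ?criterion"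
    (is "?momentum \<longleftrightarrow> _")
  proof -
    have mem: "\<zeta> x \<in> algebra_bundle A AG G ex l D x" "\<zeta> x \<in> lie_algebra AG G"
      if "algebra_section A AG G ex l D \<zeta>" for \<zeta> x
      using that by (auto simp: algebra_section_def algebra_bundle_def)
    have "?momentum \<longleftrightarrow> (\<forall>\<zeta>. algebra_section A AG G ex l D \<zeta> \<longrightarrow>
        (\<forall>k\<in>{1..N - 1}. vertical_defect (q (k - 1)) (q k) (q (k + 1)) (\<zeta> (q k)) = 0))"
      using mem(2) by (simp add: momentum_evolution_iff)
    also have "\<dots> \<longleftrightarrow> ?criterion"
      using mem(1) algebra_section_through by metis
    finally show ?thesis .
  qed
  show ?thesis using one two three by blast
qed

end
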